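(* For any integer parameters $d,\alpha\in\Omega(\log n)$, there is a deterministic distributed algorithm that solves the Gossip problem in $O\big((\frac{\log n}{\log\alpha})^{3}\big)$ rounds using $O\big((\frac{\log n}{\log\alpha})^{4} d\alpha^{2}(|M|+\log n)\big)$ communication bits amortized per process, where $|M|$ is the number of bits needed to encode all rumors in $M$.
   Context: Model: $n$ synchronous processes with unique ids from the commonly known set $[n]$, sharing a global clock (a clock tick is a round), connected by reliable classical point-to-point channels between every pair; in each round a process may send personalized messages to any subset of processes, receives messages sent to it in that round, and computes locally. Processes may crash (permanently stop; a crash during multicast may deliver the message to an adversary-chosen subset of recipients), with crashes chosen online by an adaptive full-information adversary. Gossip problem: there is a set $M=\{m_1,\dots,m_x\}$ of rumors distributed as inputs among some processes (at most one rumor per process); at the end every rumor given to a non-faulty process must be known to every non-faulty process. Amortized per process means total number of bits divided by $n$.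
   Formalization: The round bound is proved as O(max(1, (log n/log α)^3)): with no upper bound on α the stated bound can tend to 0 (e.g. α = 2^n), and Gossip cannot be solved in zero rounds; for α polynomial in n the two bounds agree. *)

theory Defs
  imports Complex_Main "HOL-Library.Landau_Symbols"
begin

type_synonym pid = nat

text \<open>Rumors and message contents are bit strings.\<close>

type_synonym bits = "bool list"

text \<open>
  The messages received in one round, indexed by sender. The empty string stands for
  ``no message'', so that every message that is actually sent costs at least one bit.
\<close>

type_synonym inbox = "pid \<Rightarrow> bits"

text \<open>
  A deterministic algorithm for a fixed number of processes. Local computation is
  unrestricted, so the local state of a process is taken to be everything it has seen: its id,
  its input and the inboxes of all completed rounds (oldest first, so that the length of the
  list is the value of the global clock). The field \<open>message\<close> gives the personalized message to
  each recipient in the coming round, and \<open>known\<close> the rumors that the process knows.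
\<close>

record algorithm =
  message :: "pid \<Rightarrow> bits option \<Rightarrow> inbox list \<Rightarrow> pid \<Rightarrow> bits"
  known :: "pid \<Rightarrow> bits option \<Rightarrow> inbox list \<Rightarrow> bits set"

record config =
  alive :: "pid set"
  history :: "pid \<Rightarrow> inbox list"

text \<open>
  An adaptive full-information adversary decides at the start of each round, on the basis of the
  whole current configuration: \<open>None\<close> lets the process continue, while \<open>Some R\<close> crashes it during
  this round, its messages of this round reaching only the recipients in \<open>R\<close>. The number of
  crashes is not bounded.
\<close>

type_synonym adversary = "config \<Rightarrow> pid \<Rightarrow> pid set option"

definition outgoing ::
    "algorithm \<Rightarrow> (pid \<Rightarrow> bits option) \<Rightarrow> config \<Rightarrow> pid \<Rightarrow> pid \<Rightarrow> bits" where
  "outgoing A inp c p q =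
     (if p \<in> alive c \<and> q \<noteq> p then message A p (inp p) (history c p) q else [])"

definition delivered ::
    "algorithm \<Rightarrow> (pid \<Rightarrow> bits option) \<Rightarrow> adversary \<Rightarrow> config \<Rightarrow> pid \<Rightarrow> inbox" where
  "delivered A inp adv c q = (\<lambda>p.
     case adv c p of
       None \<Rightarrow> outgoing A inp c p q
     | Some R \<Rightarrow> (if q \<in> R then outgoing A inp c p q else []))"

definition step ::
    "algorithm \<Rightarrow> (pid \<Rightarrow> bits option) \<Rightarrow> adversary \<Rightarrow> config \<Rightarrow> config" where
  "step A inp adv c =
     (let S = {p \<in> alive c. adv c p = None} in
      \<lparr> alive = S,
        history = (\<lambda>q. if q \<in> S then history c q @ [delivered A inp adv c q] else history c q) \<rparr>)"

text \<open>The configuration after \<open>t\<close> rounds; the processes are \<open>{1..n}\<close>.\<close>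

definition run ::
    "nat \<Rightarrow> algorithm \<Rightarrow> (pid \<Rightarrow> bits option) \<Rightarrow> adversary \<Rightarrow> nat \<Rightarrow> config" where
  "run n A inp adv t = (step A inp adv ^^ t) \<lparr> alive = {1..n}, history = (\<lambda>_. []) \<rparr>"

text \<open>
  All messages a process sends are charged, including the ones lost because the sender
  crashes in that round or because the recipient has crashed.
\<close>

definition total_bits ::
    "nat \<Rightarrow> algorithm \<Rightarrow> (pid \<Rightarrow> bits option) \<Rightarrow> adversary \<Rightarrow> nat \<Rightarrow> nat" where
  "total_bits n A inp adv T =
     (\<Sum>t<T. \<Sum>p\<in>{1..n}. \<Sum>q\<in>{1..n}. length (outgoing A inp (run n A inp adv t) p q))"

text \<open>
  The set of rumors. It is determined by the inputs; several processes may be given the same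
  rumor, which then is counted once in \<open>rumor_bits\<close>.
\<close>

definition rumors :: "nat \<Rightarrow> (pid \<Rightarrow> bits option) \<Rightarrow> bits set" where
  "rumors n inp = {m. \<exists>p\<in>{1..n}. inp p = Some m}"

definition rumor_bits :: "nat \<Rightarrow> (pid \<Rightarrow> bits option) \<Rightarrow> nat" where
  "rumor_bits n inp = (\<Sum>m\<in>rumors n inp. length m)"

text \<open>
  The non-faulty processes are those alive after the last round. The inclusion in \<open>rumors\<close>
  expresses that a rumor can only be known if it really is one of the inputs; without it,
  claiming to know every bit string would solve the problem.
\<close>

definition solves_gossip :: "nat \<Rightarrow> algorithm \<Rightarrow> nat \<Rightarrow> bool" where
  "solves_gossip n A T \<longleftrightarrow>
     (\<forall>inp adv. let c = run n A inp adv T in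
        \<forall>p\<in>alive c.
          known A p (inp p) (history c p) \<subseteq> rumors n inp \<and>
          (\<forall>q\<in>alive c. \<forall>m. inp q = Some m \<longrightarrow> m \<in> known A p (inp p) (history c p)))"

end

(*
  Let b be about the fourth root of alpha. For a scale j let m_j be about n / r^j with r = 64 b^2,
  and let G_j be a random digraph on the processes with out-degree D_j about (log n) r^j. Then
  G_j expands: a set of at most m_j vertices, each with delta out-neighbours in Y, has size less
  than |Y| / b. And it is dense: there are many edges from any m_j vertices to any 16 b m_j.

  Phase j of an epoch uses G_j. For 2g+1 steps with b^g >= n, every active process sends what it
  knows along its edges in G_j and G_(j+1) and collects answers; it passes if in each step at
  least delta out-neighbours answer that they have not failed yet. By expansion, a process that
  passes has reached, and heard from, m_j processes; it rests for the remainder of the epoch.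
  By density, only O(b m_j) survivors fail, so that the growing degree of the next phases
  is paid for by few processes. In the last phase the processes still active contact everybody.

  Since the number of survivors drops by a factor b at most log_b n times, some pair of
  consecutive epochs loses at most such a factor. There a process can only pass at scales so
  fine that the m_j processes it reaches have edges in G_(j+1) to any half of the set S of survivors.
  So in the first of the two epochs its rumor gets to more than half of S, and in the second
  epoch every process of S hears from one of these. If alpha >= n, one round of broadcasting
  is cheap enough.
*)

theory Submission
  imports Defs "HOL-Library.FuncSet" "HOL-Real_Asymp.Real_Asymp"
begin

text \<open>The adversary adapts to everything, so the graphs must be good for all vertex sets at
  once; this is why existence is shown by a union bound over all pairs of sets. A single threshold
  \<open>\<delta>\<close> serves both directions of the probing. With l about log n, a vertex has on
  average at most 32 b l edges into a set of size b m and at least 256 b l edges into a set of size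
  16 b m; \<open>\<delta>\<close> = 72 b l lies between. Hence \<open>\<delta>\<close> edges per
  vertex force growth, while a large set of survivors contains a core in which everybody has
  \<open>\<delta>\<close> neighbours, so that the core never fails. A neighbour that has not failed
  by some step had itself \<open>\<delta>\<close> such neighbours in every earlier step. The search
  from a passing process therefore runs backwards in time, and an edge found at step 2 g - i is used
  a second time at step i. This yields exchange in both directions and leaves the middle step free
  for an edge of the next graph into a prescribed set.\<close>

section \<open>Random digraphs\<close>

text \<open>The moment generating function of the number of edges from F into Y, with counting in
  place of probability. The values of h are independent, so the sum over all h factors over the
  edges: an edge of F contributes n + (t - 1) |Y|, any other edge n.\<close>

lemma sum_PiE_power_card:
  fixes t :: real
  assumes fin: "finite E" "finite V" and F: "F \<subseteq> E" and Y: "Y \<subseteq> V"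
  shows "(\<Sum>h\<in>E \<rightarrow>\<^sub>E V. t ^ card {e\<in>F. h e \<in> Y}) =
    (real (card V) + (t - 1) * real (card Y)) ^ card F * real (card V) ^ (card E - card F)"
proof -
  have fF: "finite F" and fY: "finite Y"
    using fin F Y by (auto intro: finite_subset)
  define w where "w e v = (if e \<in> F \<and> v \<in> Y then t else 1)" for e v
  have eq: "t ^ card {e\<in>F. h e \<in> Y} = (\<Prod>e\<in>E. w e (h e))" for h
  proof -
    have "(\<Prod>e\<in>E. w e (h e)) = (\<Prod>e\<in>{e\<in>E. e \<in> F \<and> h e \<in> Y}. t)"
      unfolding w_def using fin(1) by (simp only: prod.inter_filter)
    also have "{e\<in>E. e \<in> F \<and> h e \<in> Y} = {e\<in>F. h e \<in> Y}"
      using F by auto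
    finally show ?thesis by simp
  qed
  have inner: "(\<Sum>v\<in>V. w e v) =
      (if e \<in> F then real (card V) + (t - 1) * real (card Y) else real (card V))" for e
  proof (cases "e \<in> F")
    case True
    have "(\<Sum>v\<in>V. w e v) = (\<Sum>v\<in>V. 1 + (if v \<in> Y then t - 1 else 0))"
      using True by (intro sum.cong) (auto simp: w_def)
    also have "\<dots> = real (card V) + (\<Sum>v\<in>V. if v \<in> Y then t - 1 else 0)"
      by (simp add: sum.distrib)
    also have "(\<Sum>v\<in>V. if v \<in> Y then t - 1 else 0) = (\<Sum>v\<in>V \<inter> Y. t - 1)"
      using fin(2) by (simp only: sum.inter_restrict)
    also have "V \<inter> Y = Y" using Y by auto
    finally show ?thesis using True by (simp add: mult.commute)
  qed (simp add: w_def)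
  have "(\<Sum>h\<in>E \<rightarrow>\<^sub>E V. t ^ card {e\<in>F. h e \<in> Y}) = (\<Prod>e\<in>E. \<Sum>v\<in>V. w e v)"
    unfolding eq by (rule prod_sum_PiE [symmetric]) (use fin in auto)
  also have "\<dots> = (\<Prod>e\<in>F. \<Sum>v\<in>V. w e v) * (\<Prod>e\<in>E - F. \<Sum>v\<in>V. w e v)"
    using prod.subset_diff [OF F fin(1)] by (simp add: mult.commute)
  also have "(\<Prod>e\<in>F. \<Sum>v\<in>V. w e v) = (real (card V) + (t - 1) * real (card Y)) ^ card F"
    by (simp add: inner)
  also have "(\<Prod>e\<in>E - F. \<Sum>v\<in>V. w e v) = real (card V) ^ (card E - card F)"
    using F fF by (simp add: inner card_Diff_subset)
  finally show ?thesis .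
qed

lemma sum_PiE_power_card_le:
  fixes t :: real
  assumes fin: "finite E" "finite V" "V \<noteq> {}" and F: "F \<subseteq> E" and Y: "Y \<subseteq> V" and t: "t \<ge> 0"
  shows "(\<Sum>h\<in>E \<rightarrow>\<^sub>E V. t ^ card {e\<in>F. h e \<in> Y}) \<le>
    real (card (E \<rightarrow>\<^sub>E V)) * exp ((t - 1) * real (card F) * real (card Y) / real (card V))"
proof -
  let ?n = "real (card V)" and ?y = "real (card Y)" and ?x = "card F"
  have n: "?n > 0" using fin by (simp add: card_gt_0_iff)
  have yn: "?y \<le> ?n" using Y fin by (simp add: card_mono)
  have xE: "?x \<le> card E" using F fin by (simp add: card_mono)
  have nonneg: "0 \<le> ?n + (t - 1) * ?y"
  proof -
    have "?n + (t - 1) * ?y = (?n - ?y) + t * ?y" by (simp add: algebra_simps)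
    then show ?thesis using yn t by (simp only:) (intro add_nonneg_nonneg mult_nonneg_nonneg; simp)
  qed
  have "?n + (t - 1) * ?y = ?n * (1 + (t - 1) * ?y / ?n)"
    using n by (simp add: field_simps)
  also have "\<dots> \<le> ?n * exp ((t - 1) * ?y / ?n)"
    using n by (intro mult_left_mono exp_ge_add_one_self) auto
  finally have "(?n + (t - 1) * ?y) ^ ?x \<le> (?n * exp ((t - 1) * ?y / ?n)) ^ ?x"
    using nonneg by (rule power_mono)
  also have "\<dots> = ?n ^ ?x * exp ((t - 1) * real ?x * ?y / ?n)"
    by (simp add: power_mult_distrib exp_of_nat_mult [symmetric] algebra_simps)
  finally have "(\<Sum>h\<in>E \<rightarrow>\<^sub>E V. t ^ card {e\<in>F. h e \<in> Y}) \<le>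
      ?n ^ ?x * exp ((t - 1) * real ?x * ?y / ?n) * ?n ^ (card E - ?x)"
    unfolding sum_PiE_power_card [OF fin(1,2) F Y] using n by (intro mult_right_mono) auto
  also have "\<dots> = ?n ^ (?x + (card E - ?x)) * exp ((t - 1) * real ?x * ?y / ?n)"
    by (simp only: power_add mult_ac)
  also have "?n ^ (?x + (card E - ?x)) = real (card (E \<rightarrow>\<^sub>E V))"
    using xE fin by (simp add: card_PiE)
  finally show ?thesis .
qed

text \<open>Markov's inequality for 2 to the number of hits. The base need not be optimized, since
  the thresholds used later are a constant factor away from the mean.\<close>

lemma card_PiE_many_hits:
  assumes fin: "finite E" "finite V" "V \<noteq> {}" and F: "F \<subseteq> E" and Y: "Y \<subseteq> V"
  shows "real (card {h\<in>E \<rightarrow>\<^sub>E V. a \<le> card {e\<in>F. h e \<in> Y}}) \<le>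
    real (card (E \<rightarrow>\<^sub>E V)) * exp (real (card F) * real (card Y) / real (card V) - real a * ln 2)"
proof -
  let ?B = "{h\<in>E \<rightarrow>\<^sub>E V. a \<le> card {e\<in>F. h e \<in> Y}}"
  have fP: "finite (E \<rightarrow>\<^sub>E V)" using fin by (simp add: finite_PiE)
  have "real (card ?B) * 2 ^ a = (\<Sum>h\<in>?B. (2::real) ^ a)" by simp
  also have "\<dots> \<le> (\<Sum>h\<in>?B. 2 ^ card {e\<in>F. h e \<in> Y})"
    by (intro sum_mono power_increasing) auto
  also have "\<dots> \<le> (\<Sum>h\<in>E \<rightarrow>\<^sub>E V. 2 ^ card {e\<in>F. h e \<in> Y})"
    using fP by (intro sum_mono2) auto
  also have "\<dots> \<le> real (card (E \<rightarrow>\<^sub>E V)) * exp (real (card F) * real (card Y) / real (card V))"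
    using sum_PiE_power_card_le [OF fin F Y, of 2] by simp
  finally have "real (card ?B) * 2 ^ a / 2 ^ a
      \<le> real (card (E \<rightarrow>\<^sub>E V)) * exp (real (card F) * real (card Y) / real (card V)) / 2 ^ a"
    by (rule divide_right_mono) simp
  moreover have "(2::real) ^ a = exp (real a * ln 2)"
    by (simp add: exp_of_nat_mult)
  ultimately show ?thesis by (simp add: exp_diff)
qed

text \<open>The lower tail, from Markov's inequality with base 1/2, whose exponent retains half of
  the mean.\<close>

lemma card_PiE_few_hits:
  assumes fin: "finite E" "finite V" "V \<noteq> {}" and F: "F \<subseteq> E" and Y: "Y \<subseteq> V"
  shows "real (card {h\<in>E \<rightarrow>\<^sub>E V. card {e\<in>F. h e \<in> Y} < a}) \<le>
    real (card (E \<rightarrow>\<^sub>E V)) *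
      exp (real a * ln 2 - real (card F) * real (card Y) / (2 * real (card V)))"
proof -
  let ?B = "{h\<in>E \<rightarrow>\<^sub>E V. card {e\<in>F. h e \<in> Y} < a}"
  have fP: "finite (E \<rightarrow>\<^sub>E V)" using fin by (simp add: finite_PiE)
  have "real (card ?B) * (1/2) ^ a = (\<Sum>h\<in>?B. (1/2::real) ^ a)" by simp
  also have "\<dots> \<le> (\<Sum>h\<in>?B. (1/2) ^ card {e\<in>F. h e \<in> Y})"
    by (intro sum_mono power_decreasing) auto
  also have "\<dots> \<le> (\<Sum>h\<in>E \<rightarrow>\<^sub>E V. (1/2) ^ card {e\<in>F. h e \<in> Y})"
    using fP by (intro sum_mono2) auto
  also have "\<dots> \<le> real (card (E \<rightarrow>\<^sub>E V)) *
      exp (- (real (card F) * real (card Y) / (2 * real (card V))))"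
    using sum_PiE_power_card_le [OF fin F Y, of "1/2"] by simp
  finally have "real (card ?B) * (1/2) ^ a * 2 ^ a \<le> real (card (E \<rightarrow>\<^sub>E V)) *
      exp (- (real (card F) * real (card Y) / (2 * real (card V)))) * 2 ^ a"
    by (rule mult_right_mono) simp
  moreover have "real (card ?B) * (1/2) ^ a * 2 ^ a = real (card ?B)"
    by (simp add: power_divide)
  moreover have "(2::real) ^ a = exp (real a * ln 2)"
    by (simp add: exp_of_nat_mult)
  ultimately show ?thesis
    by (simp only: exp_add [symmetric] mult.assoc) (simp add: algebra_simps)
qed

text \<open>Edges are counted with multiplicity: out-edges are indexed by k < D and may coincide or
  be loops, so that the D choices of a vertex can be independent.\<close>

definition hits :: "(nat \<Rightarrow> nat \<Rightarrow> nat) \<Rightarrow> nat \<Rightarrow> nat set \<Rightarrow> nat set \<Rightarrow> nat" where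
  "hits f D X Y = (\<Sum>p\<in>X. card {k. k < D \<and> f p k \<in> Y})"

lemma hits_alt:
  assumes "finite X"
  shows "hits f D X Y = card {e \<in> X \<times> {..<D}. case_prod f e \<in> Y}"
proof -
  have "{e \<in> X \<times> {..<D}. case_prod f e \<in> Y} = (SIGMA p:X. {k. k < D \<and> f p k \<in> Y})"
    by auto
  then show ?thesis using assms by (simp add: hits_def card_SigmaI)
qed

lemma sum_power_card_Pow:
  fixes q :: real
  assumes "finite A"
  shows "(\<Sum>X\<in>Pow A. q ^ card X) = (1 + q) ^ card A"
proof -
  have "(1 + q) ^ card A = (\<Prod>a\<in>A. q + 1)" by (simp add: add.commute)
  also have "\<dots> = (\<Sum>X\<in>Pow A. (\<Prod>a\<in>X. q) * (\<Prod>a\<in>A - X. 1))"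
    using assms by (rule prod_add)
  finally show ?thesis by simp
qed

text \<open>
  The weights for the union bound over all pairs of vertex sets: a random digraph violates a
  requirement at \<open>X\<close>, \<open>Y\<close> with at most the probability that is summed here.
\<close>

lemma sum_pair_weights_less_1:
  fixes V :: "nat set"
  assumes fin: "finite V" and n: "card V \<ge> 3"
  shows "(\<Sum>X\<in>Pow V - {{}}. \<Sum>Y\<in>Pow V. (1 / real (card V)^2) ^ (card X + card Y)) < 1"
proof -
  let ?q = "1 / real (card V)^2"
  let ?s = "(1 + ?q) ^ card V"
  have "(1 + ?q) ^ card V \<le> exp ?q ^ card V"
    by (intro power_mono exp_ge_add_one_self) auto
  also have "\<dots> = exp (1 / real (card V))"
    using n by (simp add: exp_of_nat_mult [symmetric] power2_eq_square)
  also have "\<dots> \<le> exp (1/3)" using n by (simp add: field_simps)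
  also have "\<dots> \<le> 1 + 1/3 + (1/3)^2" by (rule exp_bound) auto
  finally have s: "?s \<le> 13/9" by (simp add: power2_eq_square)
  have s0: "?s > 0" by (auto intro!: zero_less_power add_pos_nonneg)
  have "(\<Sum>X\<in>Pow V - {{}}. \<Sum>Y\<in>Pow V. ?q ^ (card X + card Y)) =
      (\<Sum>X\<in>Pow V - {{}}. ?q ^ card X) * (\<Sum>Y\<in>Pow V. ?q ^ card Y)"
    by (simp add: power_add sum_product)
  \<comment> \<open>Omitting the empty X turns one factor \<open>?s\<close> into
    \<open>?s - 1\<close>; with both factors \<open>?s\<close> the product would exceed 1.\<close>
  also have "(\<Sum>X\<in>Pow V - {{}}. ?q ^ card X) = ?s - 1"
    using fin by (subst sum_diff1) (auto simp: sum_power_card_Pow)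
  also have "(\<Sum>Y\<in>Pow V. ?q ^ card Y) = ?s"
    by (rule sum_power_card_Pow [OF fin])
  also have "(?s - 1) * ?s \<le> (4/9) * (13/9)"
    using s s0 by (intro mult_mono) auto
  also have "\<dots> < 1" by simp
  finally show ?thesis .
qed

text \<open>All out-edges are chosen independently and uniformly. The bounds on \<open>m * D\<close>
  fix the mean number of hits of a pair X, Y up to a factor 2, and both tails then have probability
  at most n to the power -2 (|X| + |Y|), which the union bound can afford.\<close>

lemma random_digraph_exists:
  fixes V :: "nat set" and D b l m :: nat
  assumes fin: "finite V" and n3: "card V \<ge> 3" and b: "b \<ge> 1" 
    and l: "ln (real (card V)) \<le> real l"
    and m1: "16 * l * card V \<le> m * D" and m2: "m * D \<le> 32 * l * card V"
  obtains f where "\<And>p k. p \<in> V \<Longrightarrow> k < D \<Longrightarrow> f p k \<in> V"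
    and "\<And>X Y. X \<subseteq> V \<Longrightarrow> Y \<subseteq> V \<Longrightarrow> X \<noteq> {} \<Longrightarrow> card X \<le> m \<Longrightarrow> 72 * b * l * card X \<le> hits f D X Y
      \<Longrightarrow> b * card X < card Y"
    and "\<And>X Y. X \<subseteq> V \<Longrightarrow> Y \<subseteq> V \<Longrightarrow> card X = m \<Longrightarrow> card Y = 16 * b * m
      \<Longrightarrow> 72 * b * l * m \<le> hits f D X Y"
proof -
  let ?n = "real (card V)" and ?E = "V \<times> {..<D}"
  let ?\<Omega> = "?E \<rightarrow>\<^sub>E V" and ?q = "1 / real (card V)^2"
  define H where "H h X Y = card {e \<in> X \<times> {..<D}. h e \<in> Y}" for h :: "nat \<times> nat \<Rightarrow> nat" and X Y
  define bad where "bad h X Y \<longleftrightarrow>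
    card X \<le> m \<and> card Y \<le> b * card X \<and> 72 * b * l * card X \<le> H h X Y \<or>
    card X = m \<and> card Y = 16 * b * m \<and> H h X Y < 72 * b * l * m" for h X Y
  have V: "V \<noteq> {}" and n0: "?n > 0" using n3 by auto
  have ln2: "ln 2 \<ge> (1/2::real)"
    using ln_le_minus_one [of "1/2"] by (simp add: ln_div)
  have ln21: "ln 2 \<le> (1::real)" using ln_le_minus_one [of 2] by simp
  have fE: "finite ?E" using fin by simp
  have f\<Omega>: "finite ?\<Omega>" using fin by (intro finite_PiE) auto
  have \<Omega>0: "card ?\<Omega> > 0"
    using f\<Omega> V by (auto simp: card_gt_0_iff PiE_eq_empty_iff)
  have mD1: "16 * l * ?n \<le> real m * real D" using m1
    by (simp only: of_nat_mult [symmetric] of_nat_le_iff)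
  have mD2: "real m * real D \<le> 32 * l * ?n" using m2
    by (simp only: of_nat_mult [symmetric] of_nat_le_iff)
  have q: "exp (- 2 * real l * real k) \<le> ?q ^ k" for k
  proof -
    have "exp (- 2 * real l * real k) \<le> exp (- 2 * ln ?n * real k)"
      using l by (simp add: mult_right_mono)
    also have "\<dots> = exp (real k * (- 2 * ln ?n))" by (simp add: algebra_simps)
    also have "\<dots> = exp (- 2 * ln ?n) ^ k" by (rule exp_of_nat_mult)
    also have "exp (- 2 * ln ?n) = ?q"
      using n0 by (simp add: exp_minus exp_double divide_inverse)
    finally show ?thesis .
  qed
  have count: "real (card {h\<in>?\<Omega>. bad h X Y}) \<le> real (card ?\<Omega>) * ?q ^ (card X + card Y)"
    if X: "X \<subseteq> V" "X \<noteq> {}" and Y: "Y \<subseteq> V" for X Y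
  proof -
    let ?x = "real (card X)" and ?y = "real (card Y)"
    have sub: "X \<times> {..<D} \<subseteq> ?E" using X by auto
    have finX: "finite X" using X fin by (auto intro: finite_subset)
    have x1: "?x \<ge> 1" using X finX by (simp add: Suc_le_eq card_gt_0_iff)
    have fin': "finite {h\<in>?\<Omega>. P h}" for P using f\<Omega> by simp
    consider (up) "card X \<le> m" "card Y \<le> b * card X"
      | (low) "card X = m" "card Y = 16 * b * m" "\<not> card Y \<le> b * card X" 
      | (none) "\<And>h. \<not> bad h X Y"
    proof (cases "card X \<le> m \<and> card Y \<le> b * card X")
      case False
      then show ?thesis
        by (cases "card X = m \<and> card Y = 16 * b * m") (auto simp: bad_def intro: that)
    qed (use that in blast)
    then show ?thesis
    proof cases
      case up
      have y: "?y \<le> b * ?x"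
        using up(2) by (simp flip: of_nat_mult)
      \<comment> \<open>The two requirements never concern the same pair: 16 b m = |Y| \<le> b |X| =
        b m is impossible for nonempty X. So one tail bound per pair is enough.\<close>
      have nlow: "\<not> (card X = m \<and> card Y = 16 * b * m \<and> H h X Y < 72 * b * l * m)" for h
        using up b x1 by auto
      have "{h\<in>?\<Omega>. bad h X Y} \<subseteq> {h\<in>?\<Omega>. 72 * b * l * card X \<le> card {e\<in>X \<times> {..<D}. h e \<in> Y}}"
        using nlow by (auto simp: bad_def H_def)
      then have "real (card {h\<in>?\<Omega>. bad h X Y}) \<le>
          real (card {h\<in>?\<Omega>. 72 * b * l * card X \<le> card {e\<in>X \<times> {..<D}. h e \<in> Y}})"
        using fin' by (simp add: card_mono)
      also have "\<dots> \<le> real (card ?\<Omega>) * exp (real (card (X \<times> {..<D})) * ?y / ?n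
           - real (72 * b * l * card X) * ln 2)"
        by (rule card_PiE_many_hits [OF fE fin V sub Y])
      also have "\<dots> \<le> real (card ?\<Omega>) * exp (- 2 * real l * real (card X + card Y))"
      proof (intro mult_left_mono)
        have "real (card (X \<times> {..<D})) * ?y = (real D * ?x) * ?y"
          by (simp add: card_cartesian_product)
        also have "\<dots> \<le> (real D * ?x) * (b * ?x)" using y by (intro mult_left_mono) auto
        also have "\<dots> \<le> (real D * real m) * (b * ?x)"
          using up by (intro mult_right_mono mult_left_mono) auto
        also have "\<dots> \<le> (32 * l * ?n) * (b * ?x)"
          using mD2 by (intro mult_right_mono) (auto simp: mult.commute)
        finally have "real (card (X \<times> {..<D})) * ?y / ?n \<le> 32 * l * (b * ?x)"
          using n0 by (simp add: divide_simps mult_ac)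
        moreover have "real (72 * b * l * card X) * ln 2 \<ge> real (72 * b * l * card X) * (1/2)"
          using ln2 by (intro mult_left_mono) auto
        moreover have "real l * ?y \<le> real l * (b * ?x)" using y by (intro mult_left_mono) auto
        moreover have "real l * ?x \<le> real l * (b * ?x)"
          using b x1 by (intro mult_left_mono) auto
        \<comment> \<open>The mean is at most 32 b l |X|, and ln 2 \<ge> 1/2 leaves 36 of the 72.
          The difference 4 b l |X| pays for 2 l (|X| + |Y|), because both |X| and |Y| are at most b
          |X|.\<close>
        ultimately have "real (card (X \<times> {..<D})) * ?y / ?n - real (72 * b * l * card X) * ln 2
          \<le> - 2 * real l * real (card X + card Y)"
        proof -
          assume a: "real (card (X \<times> {..<D})) * ?y / ?n \<le> 32 * l * (b * ?x)"
            "real (72 * b * l * card X) * (1/2) \<le> real (72 * b * l * card X) * ln 2"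
            "real l * ?y \<le> real l * (b * ?x)" "real l * ?x \<le> real l * (b * ?x)"
          have 1: "real (72 * b * l * card X) * (1/2) = 36 * (real l * (b * ?x))" by simp
          have 2: "32 * l * (b * ?x) = 32 * (real l * (b * ?x))" by simp
          have 3: "- 2 * real l * real (card X + card Y) = -2 * (real l * ?x) - 2 * (real l * ?y)"
            by (simp add: algebra_simps)
          have 4: "0 \<le> real l * (b * ?x)" by simp
          show ?thesis using a 4 unfolding 1 2 3 by linarith
        qed
        then show "exp (real (card (X \<times> {..<D})) * ?y / ?n - real (72 * b * l * card X) * ln 2)
          \<le> exp (- 2 * real l * real (card X + card Y))" by simp
      qed simp
      also have "\<dots> \<le> real (card ?\<Omega>) * ?q ^ (card X + card Y)"
        by (intro mult_left_mono q) simp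
      finally show ?thesis .
    next
      case low
      have x: "?x = real m" and y: "?y = 16 * b * real m" using low by auto
      have "{h\<in>?\<Omega>. bad h X Y} \<subseteq> {h\<in>?\<Omega>. card {e\<in>X \<times> {..<D}. h e \<in> Y} < 72 * b * l * m}"
        using low by (auto simp: bad_def H_def)
      then have "real (card {h\<in>?\<Omega>. bad h X Y}) \<le>
          real (card {h\<in>?\<Omega>. card {e\<in>X \<times> {..<D}. h e \<in> Y} < 72 * b * l * m})"
        using fin' by (simp add: card_mono)
      also have "\<dots> \<le> real (card ?\<Omega>) * exp (real (72 * b * l * m) * ln 2
           - real (card (X \<times> {..<D})) * ?y / (2 * ?n))"
        by (rule card_PiE_few_hits [OF fE fin V sub Y])
      also have "\<dots> \<le> real (card ?\<Omega>) * exp (- 2 * real l * real (card X + card Y))"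
      proof (intro mult_left_mono)
        have "(16 * l * ?n) * (16 * b * real m) \<le> (real m * real D) * (16 * b * real m)"
          using mD1 by (intro mult_right_mono) auto
        also have "\<dots> = real (card (X \<times> {..<D})) * ?y"
          using x y by (simp add: card_cartesian_product)
        finally have "real (card (X \<times> {..<D})) * ?y / (2 * ?n) \<ge> 128 * l * (b * real m)"
          using n0 by (simp add: divide_simps mult_ac)
        moreover have "real (72 * b * l * m) * ln 2 \<le> real (72 * b * l * m) * 1"
          using ln21 by (intro mult_left_mono) auto
        moreover have "real l * real m \<le> real l * (b * real m)"
          using b mult_right_mono [of 1 "real b" "real m"] by (intro mult_left_mono) auto
        \<comment> \<open>Half of the mean is at least 128 b l m, and ln 2 \<le> 1 makes the
          threshold cost at most 72 b l m. The remaining 56 b l m exceed 2 l m + 32 b l m.\<close>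
        ultimately have "real (72 * b * l * m) * ln 2 - real (card (X \<times> {..<D})) * ?y / (2 * ?n)
          \<le> - 2 * real l * real (card X + card Y)"
        proof -
          assume a: "128 * l * (b * real m) \<le> real (card (X \<times> {..<D})) * ?y / (2 * ?n)"
            "real (72 * b * l * m) * ln 2 \<le> real (72 * b * l * m) * 1"
            "real l * real m \<le> real l * (b * real m)"
          have 1: "real (72 * b * l * m) * 1 = 72 * (real l * (real b * real m))" by simp
          have 2: "128 * l * (b * real m) = 128 * (real l * (real b * real m))" by simp
          have 3: "- 2 * real l * real (card X + card Y) = - 2 * (real l * m) - 32 * (real l * (real b * real m))"
            using x y by (simp add: algebra_simps)
          have 4: "0 \<le> real l * (real b * real m)" by simp
          show ?thesis using a 4 unfolding 1 2 3 by linarith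
        qed
        then show "exp (real (72 * b * l * m) * ln 2 - real (card (X \<times> {..<D})) * ?y / (2 * ?n))
          \<le> exp (- 2 * real l * real (card X + card Y))" by simp
      qed simp
      also have "\<dots> \<le> real (card ?\<Omega>) * ?q ^ (card X + card Y)"
        by (intro mult_left_mono q) simp
      finally show ?thesis .
    next
      case none
      then show ?thesis by simp
    qed
  qed
  have "\<exists>h\<in>?\<Omega>. \<forall>X\<in>Pow V - {{}}. \<forall>Y\<in>Pow V. \<not> bad h X Y"
  proof (rule ccontr)
    assume none: "\<not> ?thesis"
    define B where "B X Y = {h\<in>?\<Omega>. bad h X Y}" for X Y
    have finB: "finite (B X Y)" for X Y unfolding B_def using f\<Omega> by simp
    have finP: "finite (Pow V - {{}})" "finite (Pow V)" using fin by simp_all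
    have "?\<Omega> \<subseteq> (\<Union>X\<in>Pow V - {{}}. \<Union>Y\<in>Pow V. B X Y)"
    proof
      fix h assume h: "h \<in> ?\<Omega>"
      with none obtain X Y where "X \<in> Pow V - {{}}" "Y \<in> Pow V" "bad h X Y" by metis
      with h show "h \<in> (\<Union>X\<in>Pow V - {{}}. \<Union>Y\<in>Pow V. B X Y)"
        unfolding B_def by blast
    qed
    then have "card ?\<Omega> \<le> card (\<Union>X\<in>Pow V - {{}}. \<Union>Y\<in>Pow V. B X Y)"
      using finP finB by (intro card_mono finite_UN_I) 
    also have "\<dots> \<le> (\<Sum>X\<in>Pow V - {{}}. card (\<Union>Y\<in>Pow V. B X Y))"
      by (rule card_UN_le [OF finP(1)])
    also have "\<dots> \<le> (\<Sum>X\<in>Pow V - {{}}. \<Sum>Y\<in>Pow V. card (B X Y))"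
      by (rule sum_mono) (rule card_UN_le [OF finP(2)])
    finally have "real (card ?\<Omega>) \<le>
        real (\<Sum>X\<in>Pow V - {{}}. \<Sum>Y\<in>Pow V. card (B X Y))"
      by (simp only: of_nat_le_iff)
    also have "\<dots> = (\<Sum>X\<in>Pow V - {{}}. \<Sum>Y\<in>Pow V. real (card (B X Y)))"
      by (simp only: of_nat_sum)
    also have "\<dots> \<le> (\<Sum>X\<in>Pow V - {{}}. \<Sum>Y\<in>Pow V. real (card ?\<Omega>) * ?q ^ (card X + card Y))"
      unfolding B_def by (intro sum_mono count) blast+
    also have "\<dots> = real (card ?\<Omega>) * (\<Sum>X\<in>Pow V - {{}}. \<Sum>Y\<in>Pow V. ?q ^ (card X + card Y))"
      by (simp only: sum_distrib_left)
    also have "\<dots> < real (card ?\<Omega>) * 1"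
      using \<Omega>0 by (intro mult_strict_left_mono sum_pair_weights_less_1 [OF fin n3]) simp
    finally show False by simp
  qed
  then obtain h where h: "h \<in> ?\<Omega>" and nbad: "\<forall>X\<in>Pow V - {{}}. \<forall>Y\<in>Pow V. \<not> bad h X Y"
    by (elim bexE)
  have good: "\<not> bad h X Y" if "X \<subseteq> V" "X \<noteq> {}" "Y \<subseteq> V" for X Y
    using nbad that by blast
  have Hh: "H h X Y = hits (curry h) D X Y" if "X \<subseteq> V" for X Y
    using that fin by (subst hits_alt) (auto simp: H_def intro: finite_subset)
  show thesis
  proof (rule that [of "curry h"])
    show "curry h p k \<in> V" if "p \<in> V" "k < D" for p k
      using PiE_mem [OF h, of "(p, k)"] that by simp
    show "b * card X < card Y"
      if "X \<subseteq> V" "Y \<subseteq> V" "X \<noteq> {}" "card X \<le> m" "72 * b * l * card X \<le> hits (curry h) D X Y" for X Y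
      using good [OF that(1,3,2)] that Hh [OF that(1)] unfolding bad_def by (metis not_le)
    show "72 * b * l * m \<le> hits (curry h) D X Y"
      if "X \<subseteq> V" "Y \<subseteq> V" "card X = m" "card Y = 16 * b * m" for X Y
    proof (cases "X = {}")
      case True
      then show ?thesis using that by auto
    next
      case False
      show ?thesis
        using good [OF that(1) False that(2)] that Hh [OF that(1)] unfolding bad_def by (metis not_le)
    qed
  qed
qed

section \<open>Expanders and probing\<close>

lemma hits_mono: "Y \<subseteq> Z \<Longrightarrow> hits f D X Y \<le> hits f D X Z"
  unfolding hits_def by (intro sum_mono card_mono) auto

lemma hits_positive_edge:
  assumes "hits f D X Y > 0"
  obtains p k where "p \<in> X" "k < D" "f p k \<in> Y"
proof -
  have "\<exists>p\<in>X. card {k. k < D \<and> f p k \<in> Y} \<noteq> 0"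
  proof (rule ccontr)
    assume "\<not> ?thesis"
    then have "hits f D X Y = 0" unfolding hits_def by (intro sum.neutral) auto
    then show False using assms by simp
  qed
  then obtain p where "p \<in> X" "{k. k < D \<and> f p k \<in> Y} \<noteq> {}" by (metis card.empty)
  then show thesis using that by blast
qed

locale expander =
  fixes V :: "nat set" and f :: "nat \<Rightarrow> nat \<Rightarrow> nat" and D m \<mu> \<delta> b :: nat
  assumes finite_V: "finite V"
    and target: "p \<in> V \<Longrightarrow> k < D \<Longrightarrow> f p k \<in> V"
    and expand: "X \<subseteq> V \<Longrightarrow> Y \<subseteq> V \<Longrightarrow> X \<noteq> {} \<Longrightarrow> card X \<le> m \<Longrightarrow> \<delta> * card X \<le> hits f D X Y
      \<Longrightarrow> b * card X < card Y"
    and dense: "X \<subseteq> V \<Longrightarrow> Y \<subseteq> V \<Longrightarrow> card X = m \<Longrightarrow> card Y = \<mu> \<Longrightarrow> \<delta> * m \<le> hits f D X Y"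
    and m_pos: "m \<ge> 1" and \<delta>_pos: "\<delta> \<ge> 1" and b_pos: "b \<ge> 1"
begin

lemma dense_ge:
  assumes "X \<subseteq> V" "Y \<subseteq> V" "card X = m" "card Y \<ge> \<mu>"
  shows "\<delta> * m \<le> hits f D X Y"
proof -
  obtain Y' where Y': "Y' \<subseteq> Y" "card Y' = \<mu>" "finite Y'"
    by (rule obtain_subset_with_card_n [OF assms(4)])
  then have "\<delta> * m \<le> hits f D X Y'"
    using dense [of X Y'] assms by auto
  also have "\<dots> \<le> hits f D X Y" using Y' by (intro hits_mono)
  finally show ?thesis .
qed

lemma edge_between:
  assumes "X \<subseteq> V" "Y \<subseteq> V" "card X \<ge> m" "card Y \<ge> \<mu>"
  obtains p k where "p \<in> X" "k < D" "f p k \<in> Y"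
proof -
  obtain X' where X': "X' \<subseteq> X" "card X' = m" "finite X'"
    by (rule obtain_subset_with_card_n [OF assms(3)])
  then have "\<delta> * m \<le> hits f D X' Y"
    using dense_ge [of X' Y] assms by auto
  moreover have "\<delta> * m > 0" using m_pos \<delta>_pos by simp
  ultimately have "hits f D X' Y > 0" by linarith
  then obtain p k where "p \<in> X'" "k < D" "f p k \<in> Y" by (rule hits_positive_edge)
  then show thesis using that X' by blast
qed

text \<open>Vertices of low degree are discarded one at a time; \<open>dense\<close> rules out that \<open>m\<close> of them go.\<close>

lemma large_core:
  assumes A: "A \<subseteq> V" "card A \<ge> m + \<mu>"
  obtains C where "C \<subseteq> A" "card (A - C) < m"
    "\<And>p. p \<in> C \<Longrightarrow> \<delta> \<le> card {k. k < D \<and> f p k \<in> C}"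
proof -
  let ?deg = "\<lambda>p C. card {k. k < D \<and> f p k \<in> C}"
  have finA: "finite A" using A finite_V by (auto intro: finite_subset)
  \<comment> \<open>Either the removal has stopped with a core, or R holds the i vertices removed so
    far. Their low degree is stated with respect to the current rest \<open>A - R\<close>; it
    persists because the rest only shrinks.\<close>
  have "(\<exists>C\<subseteq>A. card (A - C) < i \<and> (\<forall>p\<in>C. \<delta> \<le> ?deg p C)) \<or>
      (\<exists>R\<subseteq>A. card R = i \<and> (\<forall>p\<in>R. ?deg p (A - R) < \<delta>))" for i
  proof (induction i)
    case 0
    show ?case by (rule disjI2, rule exI [of _ "{}"]) simp
  next
    case (Suc i)
    then show ?case
    proof
      assume "\<exists>C\<subseteq>A. card (A - C) < i \<and> (\<forall>p\<in>C. \<delta> \<le> ?deg p C)"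
      then show ?thesis using less_SucI by blast
    next
      assume "\<exists>R\<subseteq>A. card R = i \<and> (\<forall>p\<in>R. ?deg p (A - R) < \<delta>)"
      then obtain R where R: "R \<subseteq> A" "card R = i" "\<And>p. p \<in> R \<Longrightarrow> ?deg p (A - R) < \<delta>"
        by blast
      show ?thesis
      proof (cases "\<forall>p\<in>A - R. \<delta> \<le> ?deg p (A - R)")
        case True
        moreover have "card (A - (A - R)) < Suc i" using R by (simp add: double_diff)
        ultimately show ?thesis by (intro disjI1 exI [of _ "A - R"]) auto
      next
        case False
        then obtain v where v: "v \<in> A - R" "?deg v (A - R) < \<delta>" by (auto simp: not_le)
        have "?deg p (A - insert v R) < \<delta>" if "p \<in> insert v R" for p
        proof -
          have "?deg p (A - insert v R) \<le> ?deg p (A - R)" by (intro card_mono) auto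
          also have "\<dots> < \<delta>" using that v R(3) by auto
          finally show ?thesis .
        qed
        moreover have "card (insert v R) = Suc i"
          using R v finA by (auto simp: finite_subset)
        ultimately show ?thesis using R v by (intro disjI2 exI [of _ "insert v R"]) auto
      qed
    qed
  qed
  from this [of m] show thesis
  proof
    assume "\<exists>C\<subseteq>A. card (A - C) < m \<and> (\<forall>p\<in>C. \<delta> \<le> ?deg p C)"
    then show thesis using that by blast
  next
    assume "\<exists>R\<subseteq>A. card R = m \<and> (\<forall>p\<in>R. ?deg p (A - R) < \<delta>)"
    then obtain R where R: "R \<subseteq> A" "card R = m" "\<And>p. p \<in> R \<Longrightarrow> ?deg p (A - R) < \<delta>"
      by blast
    have finR: "finite R" using R finA by (auto intro: finite_subset)
    have "card (A - R) \<ge> \<mu>" using A R finR by (simp add: card_Diff_subset)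
    then have "\<delta> * m \<le> hits f D R (A - R)"
      using R A by (intro dense_ge) auto
    also have "\<dots> < (\<Sum>p\<in>R. \<delta>)"
      unfolding hits_def using R m_pos finR by (intro sum_strict_mono) auto
    finally show thesis using R by (simp add: mult.commute)
  qed
qed

end

text \<open>
  One phase of \<open>2 * g + 1\<close> probing steps. \<open>live i\<close> and \<open>K i p\<close> are the processes alive and the
  knowledge of \<open>p\<close> after \<open>i\<close> steps, and \<open>ok i p\<close> says that \<open>p\<close> has not failed a probe so far.
\<close>

locale phase = expander +
  fixes g :: nat and live :: "nat \<Rightarrow> nat set" and K :: "nat \<Rightarrow> nat \<Rightarrow> 'k set"
    and ok :: "nat \<Rightarrow> nat \<Rightarrow> bool" and act :: "nat \<Rightarrow> bool" and contact :: "nat \<Rightarrow> nat set"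
  assumes live_V: "live 0 \<subseteq> V"
    and live_Suc: "i < 2 * g + 1 \<Longrightarrow> live (Suc i) \<subseteq> live i"
    and K_Suc: "i < 2 * g + 1 \<Longrightarrow> p \<in> live (Suc i) \<Longrightarrow> K i p \<subseteq> K (Suc i) p"
    and exchange: "i < 2 * g + 1 \<Longrightarrow> p \<in> live (Suc i) \<Longrightarrow> q \<in> live (Suc i) \<Longrightarrow> act p \<Longrightarrow> q \<in> contact p
      \<Longrightarrow> K i p \<subseteq> K (Suc i) q \<and> K i q \<subseteq> K (Suc i) p"
    and out_contact: "k < D \<Longrightarrow> f p k \<in> contact p"
    and ok_0: "p \<in> live 0 \<Longrightarrow> ok 0 p \<longleftrightarrow> act p"
    and ok_SucD: "i < 2 * g + 1 \<Longrightarrow> p \<in> live (Suc i) \<Longrightarrow> ok (Suc i) p \<Longrightarrow> ok i p \<and>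
      \<delta> \<le> card {k. k < D \<and> f p k \<in> live i \<and> ok i (f p k) \<and> K i (f p k) \<subseteq> K (Suc i) p}"
    and ok_SucI: "i < 2 * g + 1 \<Longrightarrow> p \<in> live (Suc i) \<Longrightarrow> ok i p \<Longrightarrow>
      \<delta> \<le> card {k. k < D \<and> f p k \<in> live (Suc i) \<and> ok i (f p k)} \<Longrightarrow> ok (Suc i) p"
    and reach: "m \<le> b ^ g"
begin

lemma live_antimono: "i \<le> j \<Longrightarrow> j \<le> 2 * g + 1 \<Longrightarrow> live j \<subseteq> live i"
proof (induction rule: dec_induct)
  case (step n)
  then show ?case using live_Suc [of n] by auto
qed simp

lemma live_subset_V: "i \<le> 2 * g + 1 \<Longrightarrow> live i \<subseteq> V"
  using live_antimono [of 0 i] live_V by auto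

lemma K_mono: "i \<le> j \<Longrightarrow> j \<le> 2 * g + 1 \<Longrightarrow> p \<in> live j \<Longrightarrow> K i p \<subseteq> K j p"
proof (induction rule: dec_induct)
  case (step n)
  then show ?case using K_Suc [of n p] live_Suc [of n] by auto
qed simp

lemma ok_antimono: "i \<le> j \<Longrightarrow> j \<le> 2 * g + 1 \<Longrightarrow> p \<in> live j \<Longrightarrow> ok j p \<Longrightarrow> ok i p"
proof (induction rule: dec_induct)
  case (step n)
  then show ?case using ok_SucD [of n p] live_Suc [of n] by auto
qed simp

lemma ok_act: "i \<le> 2 * g + 1 \<Longrightarrow> p \<in> live i \<Longrightarrow> ok i p \<Longrightarrow> act p"
  using ok_antimono [of 0 i p] ok_0 live_antimono [of 0 i] by auto

text \<open>
  Breadth-first search from \<open>p\<close> backwards in time. A vertex found in the \<open>i\<close>-th layer has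
  survived the first \<open>2 * g + 1 - i\<close> steps; it has been told \<open>K 0 p\<close> by step \<open>i\<close>, and what it
  knew before the last \<open>i\<close> steps is known to \<open>p\<close> in the end.
\<close>

lemma passed_reach_layer:
  assumes p: "p \<in> live (2 * g + 1)" "ok (2 * g + 1) p" and i: "i \<le> g"
  shows "\<exists>X\<subseteq>live (2 * g + 1 - i). X \<noteq> {} \<and> min m (b ^ i) \<le> card X \<and>
    (\<forall>x\<in>X. ok (2 * g + 1 - i) x \<and> K 0 p \<subseteq> K i x \<and> K (2 * g + 1 - i) x \<subseteq> K (2 * g + 1) p)"
  using i
proof (induction i)
  case 0
  show ?case using p by (intro exI [of _ "{p}"]) (auto intro: K_mono)
next
  case (Suc i)
  let ?t = "2 * g - i"
  \<comment> \<open>\<open>Suc i \<le> ?t\<close> is where i < g enters: the forward spreading to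
    the new layer ends at step \<open>Suc i\<close>, no later than the time \<open>?t\<close> up to
    which that layer is known to be alive.\<close>
  have t: "2 * g + 1 - i = Suc ?t" "2 * g + 1 - Suc i = ?t" "?t < 2 * g + 1" "Suc i \<le> ?t"
    using Suc.prems by auto
  have "i \<le> g" using Suc.prems by simp
  from Suc.IH [OF this, unfolded t(1)] obtain X where
    X: "X \<subseteq> live (Suc ?t)" "X \<noteq> {}" "min m (b ^ i) \<le> card X"
    and "\<forall>x\<in>X. ok (Suc ?t) x \<and> K 0 p \<subseteq> K i x \<and> K (Suc ?t) x \<subseteq> K (2 * g + 1) p"
    by (elim exE conjE)
  then have XX: "\<And>x. x \<in> X \<Longrightarrow> ok (Suc ?t) x" "\<And>x. x \<in> X \<Longrightarrow> K 0 p \<subseteq> K i x"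
      "\<And>x. x \<in> X \<Longrightarrow> K (Suc ?t) x \<subseteq> K (2 * g + 1) p"
    by blast+
  define N where "N x = {k. k < D \<and> f x k \<in> live ?t \<and> ok ?t (f x k) \<and> K ?t (f x k) \<subseteq> K (Suc ?t) x}"
    for x
  \<comment> \<open>X is kept inside Y so that layers never shrink. This matters once a layer has
    more than m vertices, where \<open>expand\<close> says nothing.\<close>
  define Y where "Y = X \<union> {f x k |x k. x \<in> X \<and> k \<in> N x}"
  have liveX: "x \<in> live ?t" if "x \<in> X" for x using X that live_Suc [of ?t] t by auto
  have Ylive: "Y \<subseteq> live ?t" unfolding Y_def N_def using liveX by auto
  have YV: "Y \<subseteq> V" using Ylive live_subset_V [of ?t] t by auto
  have XV: "X \<subseteq> V" using YV by (auto simp: Y_def)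
  have finY: "finite Y" using YV finite_V by (rule finite_subset)
  have deg: "\<delta> \<le> card (N x)" "ok ?t x" if "x \<in> X" for x
    using ok_SucD [of ?t x] XX(1) that X t by (auto simp: N_def)
  have hits_ge: "\<delta> * card Z \<le> hits f D Z Y" if Z: "Z \<subseteq> X" for Z
  proof -
    have "\<delta> * card Z = (\<Sum>x\<in>Z. \<delta>)" by simp
    also have "\<dots> \<le> hits f D Z Y" unfolding hits_def
    proof (rule sum_mono)
      fix x assume x: "x \<in> Z"
      then have "\<delta> \<le> card (N x)" using deg Z by auto
      also have "\<dots> \<le> card {k. k < D \<and> f x k \<in> Y}"
        using x Z by (intro card_mono) (auto simp: Y_def N_def)
      finally show "\<delta> \<le> card {k. k < D \<and> f x k \<in> Y}" .
    qed
    finally show ?thesis .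
  qed
  have size: "min m (b ^ Suc i) \<le> card Y"
  proof (cases "card X \<le> m")
    case True
    then have "b * card X < card Y"
      using expand [of X Y] XV YV X hits_ge [of X] by auto
    moreover have "card X \<le> b * card X" using b_pos by simp
    moreover have "b * min m (b ^ i) \<le> b * card X" using X(3) by (rule mult_le_mono2)
    moreover have "min m (b ^ Suc i) \<le> b * min m (b ^ i)"
    proof (cases "m \<le> b ^ i")
      case True
      have "m \<le> b * m" using b_pos by simp
      with True show ?thesis by (metis min.absorb1 min.coboundedI1)
    qed simp
    ultimately show ?thesis by linarith
  next
    case False
    have "card X \<le> card Y" using finY by (intro card_mono) (auto simp: Y_def)
    then show ?thesis using False by auto
  qed
  have "ok ?t y \<and> K 0 p \<subseteq> K (Suc i) y \<and> K ?t y \<subseteq> K (2 * g + 1) p" if y: "y \<in> Y" for y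
  proof (cases "y \<in> X")
    case True
    have "y \<in> live (Suc i)" using liveX [OF True] live_antimono [of "Suc i" ?t] t by auto
    then have "K i y \<subseteq> K (Suc i) y" using K_Suc [of i y] t by auto
    moreover have "K ?t y \<subseteq> K (Suc ?t) y" using K_Suc [of ?t y] True X t by auto
    ultimately show ?thesis using deg(2) [OF True] XX(2,3) [OF True] by blast
  next
    case False
    then obtain x k where x: "x \<in> X" "k \<in> N x" and yx: "y = f x k" using y by (auto simp: Y_def)
    have yN: "k < D" "y \<in> live ?t" "ok ?t y" "K ?t y \<subseteq> K (Suc ?t) x"
      using x by (auto simp: N_def yx)
    \<comment> \<open>The edge from x to y was detected at step \<open>?t\<close>, but it already
      carried messages at step i: contacts are fixed during a phase, and x has been active since its
      start.\<close>
    have "act x" using ok_act [of ?t x] deg(2) [OF x(1)] liveX x t by auto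
    moreover have "x \<in> live (Suc i)" "y \<in> live (Suc i)"
      using liveX [OF x(1)] yN live_antimono [of "Suc i" ?t] t by auto
    ultimately have "K i x \<subseteq> K (Suc i) y"
      using exchange [of i x y] out_contact [OF yN(1)] yx t by auto
    then show ?thesis using yN XX(2,3) [OF x(1)] by blast
  qed
  then show ?case using Ylive size X t
    by (intro exI [of _ Y]) (auto simp: Y_def)
qed

text \<open>After g layers \<open>reach\<close> makes the minimum equal to m. The search consumes g
  steps at the beginning and g steps at the end of the phase; step g between them stays
  free.\<close>

lemma passed_reach:
  assumes p: "p \<in> live (2 * g + 1)" "ok (2 * g + 1) p"
  obtains X where "X \<subseteq> live (Suc g)" "m \<le> card X"
    "\<And>x. x \<in> X \<Longrightarrow> act x" "\<And>x. x \<in> X \<Longrightarrow> K 0 p \<subseteq> K g x"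
    "\<And>x. x \<in> X \<Longrightarrow> K (Suc g) x \<subseteq> K (2 * g + 1) p"
proof -
  have g: "2 * g + 1 - g = Suc g" by simp
  from passed_reach_layer [OF p order_refl, unfolded g] obtain X where
    X: "X \<subseteq> live (Suc g)" "min m (b ^ g) \<le> card X"
    and XX: "\<forall>x\<in>X. ok (Suc g) x \<and> K 0 p \<subseteq> K g x \<and> K (Suc g) x \<subseteq> K (2 * g + 1) p"
    by (elim exE conjE)
  have "act x" if "x \<in> X" for x
    using ok_act [of "Suc g" x] X(1) XX that by auto
  moreover have "m \<le> card X" using X(2) reach by simp
  ultimately show thesis using that [OF X(1)] XX by blast
qed

lemma passed_live: "p \<in> live (2 * g + 1) \<Longrightarrow> ok (2 * g + 1) p \<Longrightarrow> m \<le> card (live 0)"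
proof -
  assume "p \<in> live (2 * g + 1)" "ok (2 * g + 1) p"
  then obtain X where "X \<subseteq> live (Suc g)" "m \<le> card X" by (rule passed_reach)
  moreover have "live (Suc g) \<subseteq> live 0" by (rule live_antimono) auto
  moreover have "finite (live 0)" using live_V finite_V by (rule finite_subset)
  ultimately show ?thesis by (meson card_mono le_trans subset_trans)
qed

text \<open>The free step g carries everything over one contact from the reached set to a y in Y:
  what p spread in the first g steps goes to y, and what y knew is collected by p in the last g
  steps.\<close>

lemma passed_exchange:
  assumes p: "p \<in> live (2 * g + 1)" "ok (2 * g + 1) p" and Y: "Y \<subseteq> live (2 * g + 1)"
    and edge: "\<And>X. X \<subseteq> V \<Longrightarrow> m \<le> card X \<Longrightarrow> \<exists>x\<in>X. \<exists>y\<in>Y. y \<in> contact x"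
  obtains y where "y \<in> Y" "K 0 p \<subseteq> K (2 * g + 1) y" "K 0 y \<subseteq> K (2 * g + 1) p"
proof -
  obtain X where X: "X \<subseteq> live (Suc g)" "m \<le> card X"
    "\<And>x. x \<in> X \<Longrightarrow> act x" "\<And>x. x \<in> X \<Longrightarrow> K 0 p \<subseteq> K g x"
    "\<And>x. x \<in> X \<Longrightarrow> K (Suc g) x \<subseteq> K (2 * g + 1) p"
    by (rule passed_reach [OF p]) blast
  obtain x y where xy: "x \<in> X" "y \<in> Y" "y \<in> contact x"
    using edge [OF subset_trans [OF X(1) live_subset_V] X(2)] by auto
  have y: "y \<in> live (2 * g + 1)" "y \<in> live (Suc g)" "y \<in> live g"
    using xy Y live_antimono [of "Suc g" "2 * g + 1"] live_antimono [of g "2 * g + 1"] by auto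
  have ex: "K g x \<subseteq> K (Suc g) y" "K g y \<subseteq> K (Suc g) x"
    using exchange [of g x y] xy X y by auto
  have "K (Suc g) y \<subseteq> K (2 * g + 1) y" using y by (intro K_mono) auto
  moreover have "K 0 y \<subseteq> K g y" using y by (intro K_mono) auto
  ultimately show thesis using that [of y] ex X(4,5) [OF xy(1)] xy(2) by blast
qed

text \<open>Apply \<open>large_core\<close> to the active processes that survive the phase. The core
  members are alive throughout, so by induction each of them keeps \<open>\<delta>\<close> unfailed
  neighbours inside the core and passes; fewer than m processes lie outside it. With fewer than
  \<open>m + \<mu>\<close> active survivors nothing is to be shown.\<close>

lemma few_failures: "card {p \<in> live (2 * g + 1). act p \<and> \<not> ok (2 * g + 1) p} \<le> m + \<mu>"
proof -
  let ?A = "{p \<in> live (2 * g + 1). act p}"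
  let ?F = "{p \<in> live (2 * g + 1). act p \<and> \<not> ok (2 * g + 1) p}"
  have AV: "?A \<subseteq> V" using live_subset_V [of "2 * g + 1"] by auto
  have finA: "finite ?A" using AV finite_V by (rule finite_subset)
  show ?thesis
  proof (cases "card ?A \<ge> m + \<mu>")
    case True
    obtain C where C: "C \<subseteq> ?A" "card (?A - C) < m"
      and deg: "\<And>p. p \<in> C \<Longrightarrow> \<delta> \<le> card {k. k < D \<and> f p k \<in> C}"
      by (rule large_core [OF AV True]) blast
    have Clive: "C \<subseteq> live i" if "i \<le> 2 * g + 1" for i
      using C live_antimono [OF that] by auto
    have "\<forall>p\<in>C. ok i p" if "i \<le> 2 * g + 1" for i
      using that
    proof (induction i)
      case 0
      then show ?case using C Clive [of 0] ok_0 by auto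
    next
      case (Suc i)
      show ?case
      proof
        fix p assume p: "p \<in> C"
        have "\<delta> \<le> card {k. k < D \<and> f p k \<in> C}" by (rule deg [OF p])
        also have "\<dots> \<le> card {k. k < D \<and> f p k \<in> live (Suc i) \<and> ok i (f p k)}"
          using Suc Clive [of "Suc i"] by (intro card_mono) auto
        finally show "ok (Suc i) p"
          using ok_SucI [of i p] Suc p Clive [of "Suc i"] by auto
      qed
    qed
    then have "?F \<subseteq> ?A - C" by auto
    then have "card ?F \<le> card (?A - C)" using finA by (intro card_mono) auto
    then show ?thesis using C by simp
  next
    case False
    have "card ?F \<le> card ?A" using finA by (intro card_mono) auto
    then show ?thesis using False by simp
  qed
qed

end

section \<open>The protocol\<close>

fun encode_word :: "bits \<Rightarrow> bits" where
  "encode_word [] = [False]"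
| "encode_word (x # w) = True # x # encode_word w"

definition encode_words :: "bits list \<Rightarrow> bits" where
  "encode_words ws = concat (map encode_word ws)"

text \<open>The code is prefix-free: True announces a further bit, False ends the word.\<close>

lemma encode_word_append_inj:
  "encode_word u @ x = encode_word v @ y \<Longrightarrow> u = v \<and> x = y"
proof (induction u arbitrary: v)
  case Nil
  then show ?case by (cases v) auto
next
  case (Cons a u)
  then show ?case by (cases v) auto
qed

lemma encode_words_inj: "encode_words us = encode_words vs \<Longrightarrow> us = vs"
proof (induction us arbitrary: vs)
  case Nil
  then show ?case by (cases vs; cases "hd vs") (auto simp: encode_words_def)
next
  case (Cons u us)
  then show ?case
  proof (cases vs)
    case Nil
    with Cons.prems show ?thesis by (cases u) (auto simp: encode_words_def)
  next
    case (Cons v vs')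
    with Cons.prems have "encode_word u @ encode_words us = encode_word v @ encode_words vs'"
      by (simp add: encode_words_def)
    then have "u = v \<and> encode_words us = encode_words vs'" by (rule encode_word_append_inj)
    with Cons Cons.IH show ?thesis by auto
  qed
qed

lemma length_encode_word: "length (encode_word w) = 2 * length w + 1"
  by (induction w) auto

text \<open>The choice is made once for each set, so the encoding is a function of the set alone and
  can be inverted by any recipient.\<close>

definition list_of_set :: "bits set \<Rightarrow> bits list" where
  "list_of_set R = (SOME ws. set ws = R \<and> distinct ws)"

lemma list_of_set: "finite R \<Longrightarrow> set (list_of_set R) = R \<and> distinct (list_of_set R)"
  unfolding list_of_set_def by (rule someI_ex) (rule finite_distinct_list)

definition encode :: "bits set \<Rightarrow> bits" where
  "encode R = encode_words (list_of_set R)"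

definition decode :: "bits \<Rightarrow> bits set" where
  "decode s = (THE R. finite R \<and> encode R = s)"

lemma decode_encode:
  assumes "finite R"
  shows "decode (encode R) = R"
proof -
  have "R' = R" if "finite R'" "encode R' = encode R" for R'
  proof -
    have "list_of_set R' = list_of_set R"
      using that(2) unfolding encode_def by (rule encode_words_inj)
    then show ?thesis using list_of_set [OF assms] list_of_set [OF that(1)] by metis
  qed
  then show ?thesis using assms unfolding decode_def by (intro the_equality) auto
qed

text \<open>A nonempty word pays for its end marker by its own length, hence the factor 3. The empty
  word has no length to pay with, but it occurs at most once in a set; this is the summand
  1.\<close>

lemma length_encode:
  assumes "finite R"
  shows "length (encode R) \<le> 3 * (\<Sum>w\<in>R. length w) + 1"
proof -
  have "length (encode R) = (\<Sum>w\<leftarrow>list_of_set R. 2 * length w + 1)"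
    by (simp add: encode_def encode_words_def length_concat length_encode_word comp_def)
  also have "\<dots> = (\<Sum>w\<in>R. 2 * length w + 1)"
    using list_of_set [OF assms] by (metis sum_list_distinct_conv_sum_set)
  also have "\<dots> \<le> (\<Sum>w\<in>R. 3 * length w + (if w = [] then 1 else 0))"
  proof (rule sum_mono)
    fix w :: bits
    show "2 * length w + 1 \<le> 3 * length w + (if w = [] then 1 else 0)"
      by (cases w) auto
  qed
  also have "\<dots> = 3 * (\<Sum>w\<in>R. length w) + (\<Sum>w\<in>R. if w = [] then 1 else 0)"
    by (simp add: sum.distrib sum_distrib_left)
  also have "(\<Sum>w\<in>R. if w = [] then 1 else 0) \<le> (1::nat)"
    using assms by (simp add: sum.delta)
  finally show ?thesis by simp
qed

section \<open>Executions, and the local state machine of a process\<close>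

lemma run_0: "run n A inp adv 0 = \<lparr> alive = {1..n}, history = (\<lambda>_. []) \<rparr>"
  by (simp add: run_def)

lemma run_Suc: "run n A inp adv (Suc t) = step A inp adv (run n A inp adv t)"
  by (simp add: run_def)

lemma alive_Suc: "alive (run n A inp adv (Suc t)) = {p \<in> alive (run n A inp adv t). adv (run n A inp adv t) p = None}"
  by (simp add: run_Suc step_def Let_def)

lemma history_Suc: "p \<in> alive (run n A inp adv (Suc t)) \<Longrightarrow> history (run n A inp adv (Suc t)) p =
    history (run n A inp adv t) p @ [delivered A inp adv (run n A inp adv t) p]"
  by (simp add: run_Suc step_def Let_def)

lemma finite_rumors: "finite (rumors n inp)"
proof -
  have "rumors n inp \<subseteq> (\<lambda>p. the (inp p)) ` {1..n}" by (force simp: rumors_def)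
  then show ?thesis by (rule finite_subset) simp
qed

record state =
  now :: nat
  knows :: "bits set"
  act :: bool
  ok :: bool
  asked :: "pid set"

text \<open>
  Even rounds are requests: the active processes send all they know to their contacts. Odd rounds
  are answers. An epoch consists of \<open>N\<close> phases of \<open>2 * g + 1\<close> steps of two rounds each.
  Every message is headed by the flag \<open>ok\<close>, which implies \<open>act\<close>.
\<close>

locale protocol =
  fixes n N g \<delta> :: nat and D :: "nat \<Rightarrow> nat" and f :: "nat \<Rightarrow> pid \<Rightarrow> nat \<Rightarrow> pid"
begin

definition phase_rounds :: nat where
  "phase_rounds = 2 * (2 * g + 1)"

definition phase_of :: "nat \<Rightarrow> nat" where
  "phase_of t = (t div phase_rounds) mod N"

definition contact :: "nat \<Rightarrow> pid \<Rightarrow> pid set" where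
  "contact j p = f j p ` {..<D j} \<union> (if Suc j < N then f (Suc j) p ` {..<D (Suc j)} else {1..n})"

definition init :: "bits option \<Rightarrow> state" where
  "init x = \<lparr> now = 0, knows = set_option x, act = True, ok = True, asked = {} \<rparr>"

definition gather :: "inbox \<Rightarrow> bits set" where
  "gather h = (\<Union>q\<in>{q. h q \<noteq> []}. decode (tl (h q)))"

text \<open>The case q = p accounts for loops of the random digraph, which \<open>hits\<close>
  counts although no process sends to itself. The conjunct \<open>ok s\<close> makes a failure
  permanent within the phase.\<close>

definition probe :: "pid \<Rightarrow> state \<Rightarrow> inbox \<Rightarrow> bool" where
  "probe p s h \<longleftrightarrow> ok s \<and>
     \<delta> \<le> card {k. k < D (phase_of (now s)) \<and>
       (let q = f (phase_of (now s)) p k in q = p \<or> h q \<noteq> [] \<and> hd (h q))}"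

text \<open>At the end of a phase \<open>ok\<close> is reset to \<open>act\<close>. A resting
  process thus answers with a false flag and is never counted by a probe of another process, so
  whoever the backward search reaches has been active, sending along its own edges, during the whole
  phase.\<close>

definition trans :: "pid \<Rightarrow> state \<Rightarrow> inbox \<Rightarrow> state" where
  "trans p s h =
     (if even (now s) then
        s \<lparr> now := Suc (now s), knows := knows s \<union> gather h, asked := {q. h q \<noteq> []} \<rparr>
      else if phase_rounds dvd Suc (now s) then
        (let a = (Suc (phase_of (now s)) = N \<or> act s \<and> \<not> probe p s h) in
          \<lparr> now = Suc (now s), knows = knows s \<union> gather h, act = a, ok = a, asked = {} \<rparr>)
      else s \<lparr> now := Suc (now s), knows := knows s \<union> gather h, ok := probe p s h, asked := {} \<rparr>)"

definition state_of :: "pid \<Rightarrow> bits option \<Rightarrow> inbox list \<Rightarrow> state" where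
  "state_of p x hs = foldl (trans p) (init x) hs"

definition msg :: "pid \<Rightarrow> state \<Rightarrow> pid \<Rightarrow> bits" where
  "msg p s q =
     (if (if even (now s) then act s \<and> q \<in> contact (phase_of (now s)) p else q \<in> asked s)
      then ok s # encode (knows s) else [])"

definition alg :: algorithm where
  "alg = \<lparr> message = (\<lambda>p x hs. msg p (state_of p x hs)), known = (\<lambda>p x hs. knows (state_of p x hs)) \<rparr>"

end

locale execution = protocol +
  fixes inp :: "pid \<Rightarrow> bits option" and adv :: adversary
begin

abbreviation "conf t \<equiv> run n alg inp adv t"
abbreviation "AL t \<equiv> alive (conf t)"

definition St :: "nat \<Rightarrow> pid \<Rightarrow> state" where
  "St t p = state_of p (inp p) (history (conf t) p)"

definition inbox :: "nat \<Rightarrow> pid \<Rightarrow> inbox" where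
  "inbox t p = delivered alg inp adv (conf t) p"

abbreviation "KN t p \<equiv> knows (St t p)"

section \<open>Knowledge and flags along an execution\<close>

lemma AL_Suc: "AL (Suc t) \<subseteq> AL t"
  by (auto simp: alive_Suc)

lemma AL_antimono: "s \<le> t \<Longrightarrow> AL t \<subseteq> AL s"
  by (induction rule: dec_induct) (use AL_Suc in blast)+

lemma AL_subset: "AL t \<subseteq> {1..n}"
  using AL_antimono [of 0 t] by (simp add: run_0)

lemma finite_AL: "finite (AL t)"
  using AL_subset by (rule finite_subset) simp

lemma outgoing_eq: "outgoing alg inp (conf t) p q = (if p \<in> AL t \<and> q \<noteq> p then msg p (St t p) q else [])"
  by (simp add: outgoing_def alg_def St_def)

lemma St_0: "St 0 p = init (inp p)"
  by (simp add: St_def run_0 state_of_def)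

lemma St_Suc: "p \<in> AL (Suc t) \<Longrightarrow> St (Suc t) p = trans p (St t p) (inbox t p)"
  by (simp add: St_def history_Suc state_of_def inbox_def)

lemma inbox_alive: "q \<in> AL (Suc t) \<Longrightarrow> q \<noteq> p \<Longrightarrow> inbox t p q = msg q (St t q) p"
  by (auto simp: inbox_def delivered_def outgoing_eq alive_Suc)

lemma inbox_nonempty:
  assumes "inbox t p q \<noteq> []"
  shows "q \<in> AL t \<and> q \<noteq> p \<and> inbox t p q = msg q (St t q) p \<and> outgoing alg inp (conf t) q p \<noteq> []"
proof -
  have "inbox t p q = outgoing alg inp (conf t) q p"
    using assms unfolding inbox_def delivered_def by (auto split: option.splits if_splits)
  then show ?thesis using assms by (auto simp: outgoing_eq split: if_splits)
qed

lemma now_trans: "now (trans p s h) = Suc (now s)"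
  by (simp add: trans_def Let_def)

lemma knows_trans: "knows (trans p s h) = knows s \<union> gather h"
  by (simp add: trans_def Let_def)

lemma now_St: "p \<in> AL t \<Longrightarrow> now (St t p) = t"
proof (induction t)
  case 0
  then show ?case by (simp add: St_0 init_def)
next
  case (Suc t)
  then show ?case using AL_Suc [of t] by (auto simp: St_Suc now_trans)
qed

lemma KN_Suc: "p \<in> AL (Suc t) \<Longrightarrow> KN t p \<subseteq> KN (Suc t) p"
  by (simp add: St_Suc knows_trans)

lemma KN_mono: "s \<le> t \<Longrightarrow> p \<in> AL t \<Longrightarrow> KN s p \<subseteq> KN t p"
proof (induction rule: dec_induct)
  case (step t)
  then show ?case using KN_Suc [of p t] AL_Suc [of t] by blast
qed simp

text \<open>Besides soundness this gives finiteness of all knowledge sets, without which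
  \<open>decode\<close> would not invert \<open>encode\<close>.\<close>

lemma KN_rumors: "p \<in> AL t \<Longrightarrow> KN t p \<subseteq> rumors n inp"
proof (induction t arbitrary: p)
  case 0
  then show ?case using AL_subset [of 0] by (auto simp: St_0 init_def rumors_def)
next
  case (Suc t)
  have p: "p \<in> AL t" using Suc.prems AL_Suc by blast
  have "decode (tl (inbox t p q)) \<subseteq> rumors n inp" if q: "inbox t p q \<noteq> []" for q
  proof -
    have q': "q \<in> AL t" "inbox t p q = msg q (St t q) p" using inbox_nonempty [OF q] by auto
    then have "tl (inbox t p q) = encode (KN t q)"
      using q by (auto simp: msg_def split: if_splits)
    moreover have "KN t q \<subseteq> rumors n inp" by (rule Suc.IH [OF q'(1)])
    ultimately show ?thesis
      using finite_subset [OF _ finite_rumors] by (metis decode_encode)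
  qed
  then show ?case using Suc.IH [OF p] Suc.prems by (auto simp: St_Suc knows_trans gather_def)
qed

lemma finite_KN: "p \<in> AL t \<Longrightarrow> finite (KN t p)"
  using finite_subset [OF KN_rumors finite_rumors] .

lemma msg_nonempty: "msg q s p \<noteq> [] \<Longrightarrow> msg q s p = ok s # encode (knows s)"
  by (auto simp: msg_def split: if_splits)

lemma received_knowledge:
  assumes "p \<in> AL (Suc t)" "inbox t p q \<noteq> []"
  shows "KN t q \<subseteq> KN (Suc t) p" and "hd (inbox t p q) \<longleftrightarrow> ok (St t q)"
proof -
  have q: "q \<in> AL t" "inbox t p q = msg q (St t q) p" using inbox_nonempty [OF assms(2)] by auto
  then have eq: "inbox t p q = ok (St t q) # encode (KN t q)"
    using assms(2) msg_nonempty by metis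
  then show "hd (inbox t p q) \<longleftrightarrow> ok (St t q)" by simp
  have "decode (tl (inbox t p q)) = KN t q"
    using eq finite_KN [OF q(1)] by (simp add: decode_encode)
  then show "KN t q \<subseteq> KN (Suc t) p"
    using assms by (auto simp: St_Suc knows_trans gather_def)
qed

lemma request_round:
  assumes t: "even t" and p: "p \<in> AL (Suc t)"
  shows "act (St (Suc t) p) = act (St t p)" "ok (St (Suc t) p) = ok (St t p)"
    "asked (St (Suc t) p) = {q. inbox t p q \<noteq> []}"
proof -
  have "now (St t p) = t" using p AL_Suc now_St by blast
  then show "act (St (Suc t) p) = act (St t p)" "ok (St (Suc t) p) = ok (St t p)"
    "asked (St (Suc t) p) = {q. inbox t p q \<noteq> []}"
    using t by (simp_all add: St_Suc [OF p] trans_def)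
qed

lemma request_received:
  assumes t: "even t" and p: "p \<in> AL (Suc t)" and q: "q \<in> AL (Suc t)" "q \<noteq> p"
    and a: "act (St t p)" "q \<in> contact (phase_of t) p"
  shows "inbox t q p \<noteq> []"
proof -
  have "now (St t p) = t" using p AL_Suc now_St by blast
  then show ?thesis using inbox_alive [OF p] q t a by (simp add: msg_def)
qed

lemma request_answered:
  assumes t: "even t" and p: "p \<in> AL (Suc t)" and q: "q \<in> AL (Suc (Suc t))" "q \<noteq> p"
    and a: "act (St t p)" "q \<in> contact (phase_of t) p"
  shows "inbox (Suc t) p q \<noteq> []"
proof -
  have q': "q \<in> AL (Suc t)" using q AL_Suc by blast
  have "p \<in> asked (St (Suc t) q)"
    using request_received [OF t p q' q(2) a] request_round [OF t q'] by simp
  then show ?thesis using inbox_alive [OF q] now_St [OF q'] t by (simp add: msg_def)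
qed

lemma step_exchange:
  assumes t: "even t" and p: "p \<in> AL (Suc (Suc t))" and q: "q \<in> AL (Suc (Suc t))"
    and a: "act (St t p)" "q \<in> contact (phase_of t) p"
  shows "KN t p \<subseteq> KN (Suc (Suc t)) q" "KN t q \<subseteq> KN (Suc (Suc t)) p"
proof -
  have p': "p \<in> AL (Suc t)" and q': "q \<in> AL (Suc t)" using p q AL_Suc by blast+
  have "KN t p \<subseteq> KN (Suc (Suc t)) q \<and> KN t q \<subseteq> KN (Suc (Suc t)) p"
  proof (cases "q = p")
    case True
    then show ?thesis using KN_mono [of t "Suc (Suc t)" p] p by auto
  next
    case False
    have "KN t p \<subseteq> KN (Suc t) q"
      using received_knowledge [OF q' request_received [OF t p' q' False a]] by simp
    moreover have "KN (Suc t) q \<subseteq> KN (Suc (Suc t)) p"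
      using received_knowledge [OF p request_answered [OF t p' q False a]] by simp
    moreover have "KN (Suc t) q \<subseteq> KN (Suc (Suc t)) q" "KN t q \<subseteq> KN (Suc t) q"
      using KN_Suc q q' by auto
    ultimately show ?thesis by blast
  qed
  then show "KN t p \<subseteq> KN (Suc (Suc t)) q" "KN t q \<subseteq> KN (Suc (Suc t)) p" by auto
qed

definition probed :: "nat \<Rightarrow> pid \<Rightarrow> bool" where
  "probed t p = probe p (St (Suc t) p) (inbox (Suc t) p)"

definition flagged :: "nat \<Rightarrow> pid \<Rightarrow> pid \<Rightarrow> bool" where
  "flagged t p q \<longleftrightarrow> q = p \<or> inbox (Suc t) p q \<noteq> [] \<and> hd (inbox (Suc t) p q)"

lemma phase_of_Suc:
  assumes "even t"
  shows "phase_of (Suc t) = phase_of t"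
  using assms by (simp only: phase_of_def phase_rounds_def div_mult2_eq even_Suc_div_two)

lemma probed_iff:
  assumes t: "even t" and p: "p \<in> AL (Suc (Suc t))"
  shows "probed t p \<longleftrightarrow> ok (St t p) \<and> \<delta> \<le> card {k. k < D (phase_of t) \<and> flagged t p (f (phase_of t) p k)}"
proof -
  have p': "p \<in> AL (Suc t)" using p AL_Suc by blast
  then have "now (St (Suc t) p) = Suc t" by (rule now_St)
  then show ?thesis
    by (simp add: probed_def probe_def phase_of_Suc [OF t] request_round [OF t p'] flagged_def Let_def)
qed

lemma answer_round:
  assumes t: "even t" and p: "p \<in> AL (Suc (Suc t))"
  shows "\<not> phase_rounds dvd Suc (Suc t) \<Longrightarrow> act (St (Suc (Suc t)) p) = act (St t p)"
    "\<not> phase_rounds dvd Suc (Suc t) \<Longrightarrow> ok (St (Suc (Suc t)) p) = probed t p"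
    "phase_rounds dvd Suc (Suc t) \<Longrightarrow>
       act (St (Suc (Suc t)) p) \<longleftrightarrow> Suc (phase_of t) = N \<or> act (St t p) \<and> \<not> probed t p"
    "phase_rounds dvd Suc (Suc t) \<Longrightarrow> ok (St (Suc (Suc t)) p) = act (St (Suc (Suc t)) p)"
proof -
  have p': "p \<in> AL (Suc t)" using p AL_Suc by blast
  have nw: "now (St (Suc t) p) = Suc t" by (rule now_St [OF p'])
  note simps = St_Suc [OF p] trans_def nw t probed_def Let_def phase_of_Suc [OF t] request_round [OF t p']
  show "\<not> phase_rounds dvd Suc (Suc t) \<Longrightarrow> act (St (Suc (Suc t)) p) = act (St t p)"
    "\<not> phase_rounds dvd Suc (Suc t) \<Longrightarrow> ok (St (Suc (Suc t)) p) = probed t p"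
    "phase_rounds dvd Suc (Suc t) \<Longrightarrow>
       act (St (Suc (Suc t)) p) \<longleftrightarrow> Suc (phase_of t) = N \<or> act (St t p) \<and> \<not> probed t p"
    "phase_rounds dvd Suc (Suc t) \<Longrightarrow> ok (St (Suc (Suc t)) p) = act (St (Suc (Suc t)) p)"
    by (simp_all add: simps)
qed

lemma flaggedD:
  assumes t: "even t" and p: "p \<in> AL (Suc (Suc t))" and q: "flagged t p q" and okp: "ok (St t p)"
  shows "q \<in> AL t \<and> ok (St t q) \<and> KN t q \<subseteq> KN (Suc (Suc t)) p"
proof (cases "q = p")
  case True
  then show ?thesis using p okp KN_mono [of t "Suc (Suc t)" p] AL_antimono [of t "Suc (Suc t)"] by auto
next
  case False
  with q have i: "inbox (Suc t) p q \<noteq> []" "hd (inbox (Suc t) p q)" by (auto simp: flagged_def)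
  have q': "q \<in> AL (Suc t)" using inbox_nonempty [OF i(1)] by blast
  have "ok (St (Suc t) q)" "KN (Suc t) q \<subseteq> KN (Suc (Suc t)) p"
    using received_knowledge [OF p i(1)] i(2) by auto
  then show ?thesis using request_round(2) [OF t q'] KN_Suc [OF q'] q' AL_Suc by blast
qed

lemma flaggedI:
  assumes t: "even t" and p: "p \<in> AL (Suc (Suc t))" and q: "q \<in> AL (Suc (Suc t))" "ok (St t q)"
    and a: "act (St t p)" "q \<in> contact (phase_of t) p"
  shows "flagged t p q"
proof (cases "q = p")
  case False
  have p': "p \<in> AL (Suc t)" and q': "q \<in> AL (Suc t)" using p q AL_Suc by blast+
  have i: "inbox (Suc t) p q \<noteq> []" by (rule request_answered [OF t p' q(1) False a])
  then show ?thesis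
    using received_knowledge(2) [OF p i] request_round(2) [OF t q'] q(2) by (simp add: flagged_def)
qed (simp add: flagged_def)

end

section \<open>Correctness\<close>

text \<open>In the second scale condition, the factor b is the permitted loss of survivors in a
  quiet window and the factor 2 lets the target set be half of them. \<open>reach\<close> makes g
  steps of expansion suffice, and \<open>windows\<close> guarantees a quiet window among the first
  W.\<close>

locale expander_protocol = protocol +
  fixes b W :: nat and m \<mu> :: "nat \<Rightarrow> nat"
  assumes expander: "j < N \<Longrightarrow> expander {1..n} (f j) (D j) (m j) (\<mu> j) \<delta> b"
    and N_pos: "N \<ge> 1"
    and reach: "n \<le> b ^ g" and windows: "n < b ^ W"
    and m_le: "j < N \<Longrightarrow> m j \<le> n"
    and scale: "Suc j < N \<Longrightarrow> m (Suc j) \<le> m j" "Suc j < N \<Longrightarrow> 2 * b * \<mu> (Suc j) \<le> m j"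

locale expander_execution = expander_protocol + execution
begin

section \<open>Phases of an execution as instances of the probing analysis\<close>

lemma phase_rounds_pos: "phase_rounds > 0"
  by (simp add: phase_rounds_def)

lemma phase_of_step: "i < 2 * g + 1 \<Longrightarrow> phase_of (k * phase_rounds + 2 * i) = k mod N"
proof -
  assume "i < 2 * g + 1"
  then have "2 * i < phase_rounds" by (simp add: phase_rounds_def)
  then have "(k * phase_rounds + 2 * i) div phase_rounds = k" by simp
  then show ?thesis by (simp add: phase_of_def)
qed

lemma phase_end_iff: "i < 2 * g + 1 \<Longrightarrow>
    phase_rounds dvd Suc (Suc (k * phase_rounds + 2 * i)) \<longleftrightarrow> i = 2 * g"
proof -
  assume i: "i < 2 * g + 1"
  have "phase_rounds dvd Suc (Suc (k * phase_rounds + 2 * i)) \<longleftrightarrow> phase_rounds dvd k * phase_rounds + (2 * i + 2)"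
    by simp
  also have "\<dots> \<longleftrightarrow> phase_rounds dvd 2 * i + 2"
    by (rule dvd_add_right_iff) simp
  also have "\<dots> \<longleftrightarrow> i = 2 * g"
  proof
    assume "phase_rounds dvd 2 * i + 2"
    then have "phase_rounds \<le> 2 * i + 2" by (rule dvd_imp_le) simp
    then show "i = 2 * g" using i by (simp add: phase_rounds_def)
  qed (simp add: phase_rounds_def)
  finally show ?thesis .
qed

text \<open>At the end of a phase the flag is overwritten, so its last value is taken from \<open>probed\<close>.\<close>

definition ok_after :: "nat \<Rightarrow> nat \<Rightarrow> pid \<Rightarrow> bool" where
  "ok_after k i p =
     (if i = 0 then ok (St (k * phase_rounds) p) else probed (k * phase_rounds + 2 * (i - 1)) p)"

lemma even_phase_start: "even (k * phase_rounds + 2 * i)"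
  by (simp add: phase_rounds_def)

lemma ok_after_eq:
  assumes "i < 2 * g + 1" "p \<in> AL (k * phase_rounds + 2 * i)"
  shows "ok_after k i p = ok (St (k * phase_rounds + 2 * i) p)"
proof (cases i)
  case (Suc i')
  with assms have "p \<in> AL (Suc (Suc (k * phase_rounds + 2 * i')))" by simp
  from answer_round(2) [OF even_phase_start this] show ?thesis
    using phase_end_iff [of i' k] Suc assms by (simp add: ok_after_def)
qed (simp add: ok_after_def)

lemma act_in_phase:
  assumes "i < 2 * g + 1" "p \<in> AL (k * phase_rounds + 2 * i)"
  shows "act (St (k * phase_rounds + 2 * i) p) = act (St (k * phase_rounds) p)"
  using assms
proof (induction i)
  case (Suc i)
  have p: "p \<in> AL (Suc (Suc (k * phase_rounds + 2 * i)))" using Suc.prems by simp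
  then have "p \<in> AL (k * phase_rounds + 2 * i)"
    using AL_antimono [of "k * phase_rounds + 2 * i"] by (meson le_SucI order_refl subsetD)
  then show ?case
    using answer_round(1) [OF even_phase_start p] phase_end_iff [of i k] Suc by simp
qed simp

lemma phase_start:
  assumes "p \<in> AL (Suc k * phase_rounds)"
  shows "ok (St (Suc k * phase_rounds) p) = act (St (Suc k * phase_rounds) p)"
    and "act (St (Suc k * phase_rounds) p) \<longleftrightarrow>
      Suc (k mod N) = N \<or> act (St (k * phase_rounds) p) \<and> \<not> ok_after k (2 * g + 1) p"
proof -
  let ?t = "k * phase_rounds + 2 * (2 * g)"
  have e: "Suc (Suc ?t) = Suc k * phase_rounds" by (simp add: phase_rounds_def)
  have p: "p \<in> AL (Suc (Suc ?t))" using assms unfolding e .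
  have p': "p \<in> AL ?t" using p AL_antimono [of ?t "Suc (Suc ?t)"] by auto
  have d: "phase_rounds dvd Suc (Suc ?t)" unfolding e by simp
  note a = answer_round(3,4) [OF even_phase_start p d, unfolded e]
  show "ok (St (Suc k * phase_rounds) p) = act (St (Suc k * phase_rounds) p)"
    by (rule a(2))
  show "act (St (Suc k * phase_rounds) p) \<longleftrightarrow>
      Suc (k mod N) = N \<or> act (St (k * phase_rounds) p) \<and> \<not> ok_after k (2 * g + 1) p"
    using a(1) phase_of_step [of "2 * g" k] act_in_phase [OF _ p'] by (simp add: ok_after_def)
qed

lemma ok_phase_start:
  assumes "p \<in> AL (k * phase_rounds)"
  shows "ok (St (k * phase_rounds) p) = act (St (k * phase_rounds) p)"
proof (cases k)
  case 0
  then show ?thesis by (simp add: St_0 init_def)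
qed (use assms phase_start in auto)

lemma act_epoch_start:
  assumes "p \<in> AL (e * N * phase_rounds)"
  shows "act (St (e * N * phase_rounds) p)"
proof (cases "e * N")
  case 0
  show ?thesis unfolding 0 by (simp add: St_0 init_def)
next
  case (Suc k)
  have "Suc (k mod N) = N"
  proof -
    have "Suc k mod N = 0" using Suc by (metis mod_mult_self2_is_0)
    then show ?thesis using N_pos by (simp add: mod_Suc split: if_splits)
  qed
  then show ?thesis using assms phase_start(2) unfolding Suc by blast
qed

abbreviation "phase_live k i \<equiv> AL (k * phase_rounds + 2 * i)"

text \<open>A neighbour may crash during the step, so the adversary influences how many flags
  arrive. By \<open>flaggedD\<close> only neighbours alive at the beginning of the step are counted,
  by \<open>flaggedI\<close> all unfailed ones alive at its end are; these are the two sides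
  \<open>ok_SucD\<close> and \<open>ok_SucI\<close>.\<close>

lemma phase: "phase {1..n} (f (k mod N)) (D (k mod N)) (m (k mod N)) (\<mu> (k mod N)) \<delta> b g
    (phase_live k) (\<lambda>i. KN (k * phase_rounds + 2 * i)) (ok_after k)
    (\<lambda>p. act (St (k * phase_rounds) p)) (contact (k mod N))"
proof -
  let ?j = "k mod N" and ?t = "\<lambda>i. k * phase_rounds + 2 * i"
  have j: "?j < N" using N_pos by simp
  interpret expander "{1..n}" "f ?j" "D ?j" "m ?j" "\<mu> ?j" \<delta> b by (rule expander [OF j])
  have SS: "?t (Suc i) = Suc (Suc (?t i))" for i by simp
  have down: "p \<in> AL (?t i)" if "p \<in> AL (?t (Suc i))" for p i
    using that AL_antimono [of "?t i" "?t (Suc i)"] by auto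
  show ?thesis
  proof unfold_locales
    fix i p q
    assume i: "i < 2 * g + 1" and p: "p \<in> AL (?t (Suc i))"
    have a: "act (St (?t i) p) = act (St (k * phase_rounds) p)"
      by (rule act_in_phase [OF i down [OF p]])
    have pS: "p \<in> AL (Suc (Suc (?t i)))" using p unfolding SS .
    have o: "ok_after k i p = ok (St (?t i) p)" by (rule ok_after_eq [OF i down [OF p]])
    have ph: "phase_of (?t i) = ?j" by (rule phase_of_step [OF i])
    have oS: "ok_after k (Suc i) p \<longleftrightarrow> ok_after k i p \<and>
        \<delta> \<le> card {k'. k' < D ?j \<and> flagged (?t i) p (f ?j p k')}"
      using probed_iff [OF even_phase_start pS] o ph by (simp add: ok_after_def)
    show "KN (?t i) p \<subseteq> KN (?t (Suc i)) p" using p by (intro KN_mono) auto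
    {
      assume q: "q \<in> AL (?t (Suc i))" and act: "act (St (k * phase_rounds) p)" "q \<in> contact ?j p"
      have qS: "q \<in> AL (Suc (Suc (?t i)))" using q unfolding SS .
      show "KN (?t i) p \<subseteq> KN (?t (Suc i)) q \<and> KN (?t i) q \<subseteq> KN (?t (Suc i)) p"
        using step_exchange [OF even_phase_start pS qS] act a ph unfolding SS by auto
    }
    {
      assume "ok_after k (Suc i) p"
      then have 1: "ok_after k i p"
        and 2: "\<delta> \<le> card {k'. k' < D ?j \<and> flagged (?t i) p (f ?j p k')}"
        using oS by auto
      have okp: "ok (St (?t i) p)" using 1 o by simp
      note 2
      also have "card {k'. k' < D ?j \<and> flagged (?t i) p (f ?j p k')} \<le>
        card {k'. k' < D ?j \<and> f ?j p k' \<in> AL (?t i) \<and> ok_after k i (f ?j p k') \<and>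
          KN (?t i) (f ?j p k') \<subseteq> KN (?t (Suc i)) p}"
        using flaggedD [OF even_phase_start pS _ okp] ok_after_eq [OF i]
        by (intro card_mono) (auto simp: subset_iff)
      finally show "ok_after k i p \<and> \<delta> \<le> card {k'. k' < D ?j \<and> f ?j p k' \<in> AL (?t i) \<and>
          ok_after k i (f ?j p k') \<and> KN (?t i) (f ?j p k') \<subseteq> KN (?t (Suc i)) p}"
        using 1 by simp
    }
    {
      assume okp: "ok_after k i p"
        and 2: "\<delta> \<le> card {k'. k' < D ?j \<and> f ?j p k' \<in> AL (?t (Suc i)) \<and> ok_after k i (f ?j p k')}"
      have act_p: "act (St (?t i) p)"
      proof -
        \<comment> \<open>The fact \<open>ok_act\<close> belongs to the locale being interpreted, so
          the descent from \<open>ok_after\<close> to activity at the start of the phase is repeated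
          here.\<close>
        have "ok_after k i' p \<longrightarrow> act (St (k * phase_rounds) p)" if "i' \<le> i" for i'
          using that
        proof (induction i')
          case 0
          have "p \<in> AL (k * phase_rounds)"
            using p AL_antimono [of "k * phase_rounds" "?t (Suc i)"] by auto
          then show ?case using ok_phase_start by (simp add: ok_after_def)
        next
          case (Suc i')
          have "p \<in> AL (?t (Suc i'))"
            using p AL_antimono [of "?t (Suc i')" "?t (Suc i)"] Suc by auto
          then have "p \<in> AL (Suc (Suc (?t i')))" "p \<in> AL (?t i')" using down unfolding SS by auto
          then show ?case
            using Suc probed_iff [OF even_phase_start, of p k i'] ok_after_eq [of i' p k] i
            by (auto simp: ok_after_def)
        qed
        then show ?thesis using okp a by blast
      qed
      note 2
      also have "card {k'. k' < D ?j \<and> f ?j p k' \<in> AL (?t (Suc i)) \<and> ok_after k i (f ?j p k')} \<le>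
          card {k'. k' < D ?j \<and> flagged (?t i) p (f ?j p k')}"
      proof (intro card_mono Collect_mono impI conjI)
        fix k' assume k': "k' < D ?j \<and> f ?j p k' \<in> AL (?t (Suc i)) \<and> ok_after k i (f ?j p k')"
        then show "k' < D ?j" by simp
        have "f ?j p k' \<in> contact (phase_of (?t i)) p" using k' ph by (simp add: contact_def)
        then show "flagged (?t i) p (f ?j p k')"
          using flaggedI [OF even_phase_start pS _ _ act_p, of "f ?j p k'"] k' down
            ok_after_eq [OF i, of "f ?j p k'"] unfolding SS by blast
      qed simp
      finally show "ok_after k (Suc i) p" using oS okp by simp
    }
  next
    show "AL (?t 0) \<subseteq> {1..n}" by (rule AL_subset)
    show "AL (?t (Suc i)) \<subseteq> AL (?t i)" for i by (rule AL_antimono) simp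
    show "k' < D ?j \<Longrightarrow> f ?j p k' \<in> contact ?j p" for k' p by (simp add: contact_def)
    show "p \<in> AL (?t 0) \<Longrightarrow> ok_after k 0 p = act (St (k * phase_rounds) p)" for p
      using ok_phase_start by (simp add: ok_after_def)
    show "m ?j \<le> b ^ g" using m_le [OF j] reach by simp
  qed
qed

lemma phase_end: "k * phase_rounds + 2 * (2 * g + 1) = Suc k * phase_rounds"
  by (simp add: phase_rounds_def)

text \<open>
  The bound on the crashes makes every scale at which a probe can succeed fine enough for the
  next graph to have an edge from the reached set to \<open>Y\<close>.
\<close>

lemma epoch_exchange:
  assumes S: "S \<subseteq> AL (Suc e * N * phase_rounds)" "p \<in> S" and Y: "Y \<subseteq> S" "card S \<le> 2 * card Y"
    and few: "card (AL (e * N * phase_rounds)) \<le> b * card S"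
  shows "\<exists>y\<in>Y. KN (e * N * phase_rounds) p \<subseteq> KN (Suc e * N * phase_rounds) y \<and>
    KN (e * N * phase_rounds) y \<subseteq> KN (Suc e * N * phase_rounds) p"
proof -
  let ?k = "\<lambda>j. e * N + j" and ?P = phase_rounds
  let ?s = "e * N * ?P" and ?u = "Suc e * N * ?P"
  have finS: "finite S" using S(1) finite_AL by (rule finite_subset)
  have "card S > 0" using S finS by (auto simp: card_gt_0_iff)
  then have Y0: "card Y > 0" using Y by simp
  have kmod: "?k j mod N = j" if "j < N" for j using that by simp
  have alive: "x \<in> AL (?k j * ?P)" if "x \<in> S" "j \<le> N" for x j
  proof -
    have "?k j * ?P \<le> ?u" using that by (intro mult_le_mono1) simp
    then show ?thesis using AL_antimono S that by blast
  qed
  have before: "KN ?s x \<subseteq> KN (?k j * ?P) x" if "x \<in> S" "j \<le> N" for x j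
    using alive [OF that] by (intro KN_mono mult_le_mono1) auto
  have after: "KN (?k j * ?P) x \<subseteq> KN ?u x" if "x \<in> S" "j \<le> N" for x j
    using S that by (intro KN_mono mult_le_mono1) auto
  have main: "\<exists>y\<in>Y. KN (?k j * ?P) p \<subseteq> KN (?k (Suc j) * ?P) y \<and> KN (?k j * ?P) y \<subseteq> KN (?k (Suc j) * ?P) p
      \<Longrightarrow> j < N \<Longrightarrow> ?thesis" for j
  proof -
    assume "\<exists>y\<in>Y. KN (?k j * ?P) p \<subseteq> KN (?k (Suc j) * ?P) y \<and> KN (?k j * ?P) y \<subseteq> KN (?k (Suc j) * ?P) p"
      and j: "j < N"
    then obtain y where y: "y \<in> Y" "KN (?k j * ?P) p \<subseteq> KN (?k (Suc j) * ?P) y"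
      "KN (?k j * ?P) y \<subseteq> KN (?k (Suc j) * ?P) p" by blast
    have "y \<in> S" using y Y by blast
    with y j show ?thesis
      using before [of p j] before [of y j] after [of p "Suc j"] after [of y "Suc j"] S(2)
      by (intro bexI [OF _ y(1)]) (simp, blast)
  qed
  show ?thesis
  \<comment> \<open>If p is still active in the last phase, the first step there reaches every
    process directly. Otherwise p stopped being active at the end of an earlier phase j, which it
    can only do by passing.\<close>
  proof (cases "act (St (?k (N - 1) * ?P) p)")
    case True
    have N1: "N - 1 < N" using N_pos by simp
    interpret phase "{1..n}" "f (?k (N - 1) mod N)" "D (?k (N - 1) mod N)" "m (?k (N - 1) mod N)"
      "\<mu> (?k (N - 1) mod N)" \<delta> b g "phase_live (?k (N - 1))" "\<lambda>i. KN (?k (N - 1) * ?P + 2 * i)"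
      "ok_after (?k (N - 1))" "\<lambda>p. act (St (?k (N - 1) * ?P) p)" "contact (?k (N - 1) mod N)"
      by (rule phase)
    obtain y where y: "y \<in> Y" using Y0 by fastforce
    have live: "x \<in> phase_live (?k (N - 1)) i" if "x \<in> S" "i \<le> 2 * g + 1" for x i
    proof -
      have "?k (N - 1) * ?P + 2 * i \<le> ?k (N - 1) * ?P + 2 * (2 * g + 1)" using that by simp
      also have "\<dots> = ?k N * ?P" using phase_end [of "?k (N - 1)"] N_pos by simp
      finally show ?thesis using AL_antimono alive [OF that(1), of N] by blast
    qed
    have "contact (?k (N - 1) mod N) p \<supseteq> {1..n}" using kmod [OF N1] N_pos by (simp add: contact_def)
    moreover have "y \<in> {1..n}" using y Y S AL_subset by blast
    ultimately have c: "y \<in> contact (?k (N - 1) mod N) p" by blast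
    have "y \<in> S" using y Y by blast
    then have ex: "KN (?k (N - 1) * ?P) p \<subseteq> KN (?k (N - 1) * ?P + 2) y \<and> KN (?k (N - 1) * ?P) y \<subseteq> KN (?k (N - 1) * ?P + 2) p"
      using exchange [of 0 p y] live [OF S(2), of 1] live [of y 1] True c by simp
    have up: "KN (?k (N - 1) * ?P + 2) x \<subseteq> KN (?k (Suc (N - 1)) * ?P) x" if "x \<in> S" for x
    proof -
      have "?k (N - 1) * ?P + 2 \<le> ?k (N - 1) * ?P + 2 * (2 * g + 1)" by simp
      also have "\<dots> = ?k N * ?P" using phase_end [of "?k (N - 1)"] N_pos by simp
      finally show ?thesis using alive [OF that, of N] N_pos by (intro KN_mono) auto
    qed
    show ?thesis
      by (rule main [OF bexI [OF _ y] N1]) (use ex up [OF S(2)] up [OF \<open>y \<in> S\<close>] in blast)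
  next
    case False
    have act0: "act (St (?k 0 * ?P) p)" using act_epoch_start [of p e] alive [of p 0] S by simp
    have "\<exists>j<N - 1. act (St (?k j * ?P) p) \<and> \<not> act (St (?k (Suc j) * ?P) p)"
    proof (rule ccontr)
      assume none: "\<not> ?thesis"
      have "j \<le> N - 1 \<longrightarrow> act (St (?k j * ?P) p)" for j
      proof (induction j)
        case (Suc j)
        then show ?case using none by (metis Suc_le_eq less_imp_le)
      qed (use act0 in blast)
      then show False using False by blast
    qed
    then obtain j where j: "j < N - 1" "act (St (?k j * ?P) p)" "\<not> act (St (?k (Suc j) * ?P) p)"
      by blast
    have jN: "j < N" "Suc j < N" using j by auto
    interpret phase "{1..n}" "f (?k j mod N)" "D (?k j mod N)" "m (?k j mod N)" "\<mu> (?k j mod N)" \<delta> b g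
      "phase_live (?k j)" "\<lambda>i. KN (?k j * ?P + 2 * i)"
      "ok_after (?k j)" "\<lambda>p. act (St (?k j * ?P) p)" "contact (?k j mod N)"
      by (rule phase)
    interpret next_scale: expander "{1..n}" "f (Suc j)" "D (Suc j)" "m (Suc j)" "\<mu> (Suc j)" \<delta> b
      by (rule expander [OF jN(2)])
    have live: "x \<in> phase_live (?k j) (2 * g + 1)" if "x \<in> S" for x
      using alive [OF that, of "Suc j"] jN unfolding phase_end by simp
    have passed: "ok_after (?k j) (2 * g + 1) p"
      using phase_start(2) [of p "?k j"] j alive [of p "Suc j"] S(2) jN by (auto simp: kmod)
    \<comment> \<open>Passing certifies that m_j processes were alive. Since few crash, also b |S|
      \<ge> m_j, and cancelling b against the scale condition leaves enough room for
      \<open>\<mu> (Suc j)\<close> in half of S.\<close>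
    have "m j \<le> card (AL (?k j * ?P))"
      using passed_live [OF live [OF S(2)] passed] jN by (simp add: kmod)
    also have "\<dots> \<le> card (AL ?s)"
      using AL_antimono [of ?s "?k j * ?P"] finite_AL by (intro card_mono) auto
    also have "\<dots> \<le> b * card S" by (rule few)
    finally have mS: "m j \<le> b * card S" .
    have "b * (2 * \<mu> (Suc j)) = 2 * b * \<mu> (Suc j)" by simp
    also note scale(2) [OF jN(2)]
    also note mS
    finally have "b * (2 * \<mu> (Suc j)) \<le> b * card S" .
    then have "2 * \<mu> (Suc j) \<le> card S"
      by (rule mult_left_le_imp_le) (use b_pos in simp)
    then have muY: "\<mu> (Suc j) \<le> card Y" using Y by simp
    have edge: "\<exists>x\<in>X. \<exists>y\<in>Y. y \<in> contact (?k j mod N) x" if X: "X \<subseteq> {1..n}" "m (?k j mod N) \<le> card X" for X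
    proof -
      have mX: "m (Suc j) \<le> card X" using X scale(1) [OF jN(2)] jN by (simp add: kmod)
      have YV: "Y \<subseteq> {1..n}" using Y S AL_subset by blast
      obtain x k' where "x \<in> X" "k' < D (Suc j)" "f (Suc j) x k' \<in> Y"
        by (rule next_scale.edge_between [OF X(1) YV mX muY])
      then show ?thesis using jN by (force simp: contact_def kmod)
    qed
    have YL: "Y \<subseteq> phase_live (?k j) (2 * g + 1)" using live Y by blast
    obtain y where "y \<in> Y" "KN (?k j * ?P + 2 * 0) p \<subseteq> KN (?k j * ?P + 2 * (2 * g + 1)) y"
      "KN (?k j * ?P + 2 * 0) y \<subseteq> KN (?k j * ?P + 2 * (2 * g + 1)) p"
      by (rule passed_exchange [OF live [OF S(2)] passed YL edge])
    then show ?thesis using main [OF _ jN(1)] unfolding phase_end by auto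
  qed
qed

section \<open>Windows of two epochs and the final exchange\<close>

definition window :: nat where
  "window = 2 * N * phase_rounds"

lemma quiet_window:
  assumes "AL (W * window) \<noteq> {}"
  obtains w where "w < W" "card (AL (w * window)) \<le> b * card (AL (Suc w * window))"
proof (rule ccontr)
  assume none: "\<not> thesis"
  note found = that
  have drop: "b * card (AL (Suc w * window)) < card (AL (w * window))" if "w < W" for w
    using none found [OF that] by (meson not_le)
  have "b ^ w * card (AL (w * window)) \<le> n" if "w \<le> W" for w
    using that
  proof (induction w)
    case 0
    then show ?case by (simp add: run_0)
  next
    case (Suc w)
    have "b ^ Suc w * card (AL (Suc w * window)) = b ^ w * (b * card (AL (Suc w * window)))"
      by simp
    also have "\<dots> \<le> b ^ w * card (AL (w * window))"
      using drop [of w] Suc.prems by (intro mult_le_mono2) simp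
    also have "\<dots> \<le> n" using Suc by simp
    finally show ?case .
  qed
  then have "b ^ W * card (AL (W * window)) \<le> n" by simp
  moreover have "card (AL (W * window)) \<ge> 1"
    using assms finite_AL by (simp add: Suc_le_eq card_gt_0_iff)
  ultimately have "b ^ W * 1 \<le> n" by (meson le_trans mult_le_mono2)
  then show False using windows by simp
qed

lemma survivors_exchange:
  assumes p: "p \<in> AL (W * window)" and q: "q \<in> AL (W * window)"
  shows "KN 0 p \<subseteq> KN (W * window) q"
proof -
  obtain w where w: "w < W" "card (AL (w * window)) \<le> b * card (AL (Suc w * window))"
    using quiet_window p by blast
  \<comment> \<open>The survivors of the whole window serve as S in both epochs, although more
    processes may be alive after the first one; \<open>few2\<close> passes the crash bound on to the
    second epoch.\<close>
  let ?S = "AL (Suc w * window)" and ?P = phase_rounds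
  have le: "Suc w * window \<le> W * window" using w by (intro mult_le_mono1) simp
  have pS: "p \<in> ?S" and qS: "q \<in> ?S" using p q AL_antimono [OF le] by auto
  have e: "w * window = (2 * w) * N * ?P" "Suc w * window = Suc (Suc (2 * w)) * N * ?P"
    by (simp_all add: window_def algebra_simps)
  let ?mid = "Suc (2 * w) * N * ?P"
  have le1: "w * window \<le> ?mid" and le2: "?mid \<le> Suc w * window"
    unfolding e by (intro mult_le_mono1; simp)+
  have sub1: "?S \<subseteq> AL ?mid" by (rule AL_antimono [OF le2])
  have few2: "card (AL ?mid) \<le> b * card ?S"
    using w(2) card_mono [OF finite_AL AL_antimono [OF le1]] by simp
  define Z where "Z = {y \<in> ?S. KN (w * window) p \<subseteq> KN ?mid y}"
  have ZS: "Z \<subseteq> ?S" by (auto simp: Z_def)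
  \<comment> \<open>Otherwise at least half of S lies outside Z, and the first epoch would bring the
    knowledge of p to one of these processes.\<close>
  have "card ?S \<le> 2 * card Z"
  proof (rule ccontr)
    assume "\<not> ?thesis"
    then have "card ?S \<le> 2 * card (?S - Z)"
      using card_Diff_subset [OF finite_subset [OF ZS finite_AL] ZS] by simp
    from epoch_exchange [OF sub1 pS Diff_subset this] w(2)
    obtain y where "y \<in> ?S - Z" "KN (w * window) p \<subseteq> KN ?mid y" unfolding e(1) by blast
    then show False by (simp add: Z_def)
  qed
  from epoch_exchange [OF _ qS ZS this few2] obtain y where "y \<in> Z" "KN ?mid y \<subseteq> KN (Suc w * window) q"
    unfolding e(2) by blast
  then have "KN (w * window) p \<subseteq> KN (Suc w * window) q" by (auto simp: Z_def)
  moreover have "KN 0 p \<subseteq> KN (w * window) p"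
    using pS le1 le2 AL_antimono [of "w * window" "Suc w * window"] by (intro KN_mono) auto
  moreover have "KN (Suc w * window) q \<subseteq> KN (W * window) q" by (rule KN_mono [OF le q])
  ultimately show ?thesis by blast
qed

end

section \<open>Communication\<close>

context expander_execution
begin

definition num_messages :: "nat \<Rightarrow> nat" where
  "num_messages t = (\<Sum>p\<in>{1..n}. card {q\<in>{1..n}. outgoing alg inp (conf t) p q \<noteq> []})"

lemma length_outgoing: "length (outgoing alg inp (conf t) p q) \<le> 3 * rumor_bits n inp + 2"
proof (cases "outgoing alg inp (conf t) p q = []")
  case False
  then have p: "p \<in> AL t" and eq: "outgoing alg inp (conf t) p q = ok (St t p) # encode (KN t p)"
    using msg_nonempty by (auto simp: outgoing_eq split: if_splits)
  have "length (encode (KN t p)) \<le> 3 * (\<Sum>w\<in>KN t p. length w) + 1"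
    by (rule length_encode [OF finite_KN [OF p]])
  moreover have "(\<Sum>w\<in>KN t p. length w) \<le> rumor_bits n inp"
    unfolding rumor_bits_def by (rule sum_mono2 [OF finite_rumors KN_rumors [OF p]]) simp
  ultimately show ?thesis using eq by simp
qed simp

lemma total_bits_le: "total_bits n alg inp adv T \<le> (\<Sum>t<T. num_messages t) * (3 * rumor_bits n inp + 2)"
proof -
  let ?L = "3 * rumor_bits n inp + 2"
  have "(\<Sum>q\<in>{1..n}. length (outgoing alg inp (conf t) p q)) \<le>
      card {q\<in>{1..n}. outgoing alg inp (conf t) p q \<noteq> []} * ?L" for t p
  proof -
    have "(\<Sum>q\<in>{1..n}. length (outgoing alg inp (conf t) p q)) \<le>
        (\<Sum>q\<in>{1..n}. if outgoing alg inp (conf t) p q \<noteq> [] then ?L else 0)"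
      using length_outgoing by (intro sum_mono) simp
    also have "\<dots> = (\<Sum>q\<in>{q\<in>{1..n}. outgoing alg inp (conf t) p q \<noteq> []}. ?L)"
      by (rule sum.inter_filter [symmetric]) simp
    finally show ?thesis by simp
  qed
  then have "total_bits n alg inp adv T \<le>
      (\<Sum>t<T. \<Sum>p\<in>{1..n}. card {q\<in>{1..n}. outgoing alg inp (conf t) p q \<noteq> []} * ?L)"
    unfolding total_bits_def by (intro sum_mono)
  also have "\<dots> = (\<Sum>t<T. num_messages t) * ?L"
    unfolding num_messages_def sum_distrib_right ..
  finally show ?thesis .
qed

text \<open>Answers go to processes whose request arrived.\<close>

lemma num_answers_le:
  assumes t: "even t"
  shows "num_messages (Suc t) \<le> num_messages t"
proof -
  let ?out = "\<lambda>t p q. outgoing alg inp (conf t) p q \<noteq> []"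
  have "num_messages (Suc t) \<le> (\<Sum>p\<in>{1..n}. card {q\<in>{1..n}. ?out t q p})"
    unfolding num_messages_def
  proof (intro sum_mono card_mono subsetI)
    fix p q assume q: "q \<in> {q\<in>{1..n}. ?out (Suc t) p q}"
    then have p: "p \<in> AL (Suc t)" and m: "msg p (St (Suc t) p) q \<noteq> []"
      by (auto simp: outgoing_eq split: if_splits)
    have "q \<in> asked (St (Suc t) p)"
      using m now_St [OF p] t by (auto simp: msg_def split: if_splits)
    then have "inbox t p q \<noteq> []" using request_round(3) [OF t p] by simp
    then show "q \<in> {q\<in>{1..n}. ?out t q p}" using inbox_nonempty q by blast
  qed simp
  also have "\<dots> = (\<Sum>p\<in>{1..n}. \<Sum>q\<in>{1..n}. if ?out t q p then 1 else 0)"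
    by (simp add: sum.inter_filter [symmetric])
  also have "\<dots> = (\<Sum>q\<in>{1..n}. \<Sum>p\<in>{1..n}. if ?out t q p then 1 else 0)"
    by (rule sum.swap)
  also have "\<dots> = num_messages t"
    unfolding num_messages_def by (simp add: sum.inter_filter [symmetric])
  finally show ?thesis .
qed

text \<open>Phase 0 opens an epoch with everybody active. A later phase is left to the survivors
  that failed the phase before, which \<open>few_failures\<close> counts.\<close>

definition active_bound :: "nat \<Rightarrow> nat" where
  "active_bound j = (if j = 0 then n else m (j - 1) + \<mu> (j - 1))"

definition contact_bound :: "nat \<Rightarrow> nat" where
  "contact_bound j = D j + (if Suc j < N then D (Suc j) else n)"

lemma card_contact: "card (contact j p) \<le> contact_bound j"
proof -
  have "card (f j p ` {..<D j}) \<le> D j"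
    using card_image_le [of "{..<D j}" "f j p"] by simp
  moreover have "card (if Suc j < N then f (Suc j) p ` {..<D (Suc j)} else {1..n}) \<le>
      (if Suc j < N then D (Suc j) else n)"
    using card_image_le [of "{..<D (Suc j)}" "f (Suc j) p"] by simp
  ultimately show ?thesis
    unfolding contact_def contact_bound_def by (meson add_mono card_Un_le le_trans)
qed

lemma card_active: "card {p \<in> AL (k * phase_rounds). act (St (k * phase_rounds) p)} \<le> active_bound (k mod N)"
proof (cases "k mod N")
  case 0
  have "card {p \<in> AL (k * phase_rounds). act (St (k * phase_rounds) p)} \<le> card {1..n}"
    using AL_subset by (intro card_mono) auto
  then show ?thesis using 0 by (simp add: active_bound_def)
next
  case (Suc j)
  then obtain k' where k: "k = Suc k'" by (cases k) auto
  have N: "Suc (k' mod N) \<noteq> N"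
    using Suc N_pos unfolding k by (auto simp: mod_Suc split: if_splits)
  then have j: "k' mod N = j"
    using Suc unfolding k by (simp add: mod_Suc split: if_splits)
  interpret phase "{1..n}" "f (k' mod N)" "D (k' mod N)" "m (k' mod N)" "\<mu> (k' mod N)" \<delta> b g
    "phase_live k'" "\<lambda>i. KN (k' * phase_rounds + 2 * i)"
    "ok_after k'" "\<lambda>p. act (St (k' * phase_rounds) p)" "contact (k' mod N)"
    by (rule phase)
  have "{p \<in> AL (k * phase_rounds). act (St (k * phase_rounds) p)} \<subseteq>
      {p \<in> phase_live k' (2 * g + 1). act (St (k' * phase_rounds) p) \<and> \<not> ok_after k' (2 * g + 1) p}"
    using phase_start(2) N unfolding k phase_end by blast
  then have "card {p \<in> AL (k * phase_rounds). act (St (k * phase_rounds) p)} \<le> m (k' mod N) + \<mu> (k' mod N)"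
    using few_failures by (rule order.trans [OF card_mono, rotated]) (simp add: finite_AL)
  then show ?thesis using j Suc by (simp add: active_bound_def)
qed

lemma num_requests_le:
  assumes "i < 2 * g + 1"
  shows "num_messages (k * phase_rounds + 2 * i) \<le> active_bound (k mod N) * contact_bound (k mod N)"
proof -
  let ?t = "k * phase_rounds + 2 * i"
  let ?A = "{p \<in> AL (k * phase_rounds). act (St (k * phase_rounds) p)}"
  have A: "?A \<subseteq> {1..n}" using AL_subset by blast
  have "card {q\<in>{1..n}. outgoing alg inp (conf ?t) p q \<noteq> []} \<le> (if p \<in> ?A then contact_bound (k mod N) else 0)"
    for p
  proof -
    have sent: "p \<in> ?A \<and> q \<in> contact (k mod N) p" if "outgoing alg inp (conf ?t) p q \<noteq> []" for q
    proof -
      from that have p: "p \<in> AL ?t" and mq: "msg p (St ?t p) q \<noteq> []"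
        by (auto simp: outgoing_eq split: if_splits)
      have "act (St ?t p) \<and> q \<in> contact (phase_of ?t) p"
        using mq now_St [OF p] even_phase_start [of k i] by (simp add: msg_def split: if_splits)
      moreover have "p \<in> AL (k * phase_rounds)" using p AL_antimono [of "k * phase_rounds" ?t] by auto
      ultimately show ?thesis
        using act_in_phase [OF assms p] phase_of_step [OF assms] by simp
    qed
    show ?thesis
    proof (cases "p \<in> ?A")
      case True
      have "finite (contact (k mod N) p)" by (simp add: contact_def)
      then have "card {q\<in>{1..n}. outgoing alg inp (conf ?t) p q \<noteq> []} \<le> card (contact (k mod N) p)"
        using sent by (intro card_mono) auto
      then show ?thesis using True card_contact [of "k mod N" p] by simp
    next
      case False
      then have none: "{q\<in>{1..n}. outgoing alg inp (conf ?t) p q \<noteq> []} = {}" using sent by blast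
      show ?thesis unfolding none by simp
    qed
  qed
  then have "num_messages ?t \<le> (\<Sum>p\<in>{1..n}. if p \<in> ?A then contact_bound (k mod N) else 0)"
    unfolding num_messages_def by (rule sum_mono)
  also have "\<dots> = (\<Sum>p\<in>{1..n} \<inter> ?A. contact_bound (k mod N))"
    by (simp only: sum.inter_restrict finite_atLeastAtMost)
  also have "{1..n} \<inter> ?A = ?A" using A by blast
  also have "(\<Sum>p\<in>?A. contact_bound (k mod N)) = card ?A * contact_bound (k mod N)" by simp
  also have "\<dots> \<le> active_bound (k mod N) * contact_bound (k mod N)"
    using card_active by (rule mult_le_mono1)
  finally show ?thesis .
qed

lemma num_messages_le:
  assumes B: "\<And>j. j < N \<Longrightarrow> active_bound j * contact_bound j \<le> B"
  shows "num_messages t \<le> B"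
proof -
  have even_le: "num_messages t \<le> B" if "even t" for t
  proof -
    let ?k = "t div phase_rounds" and ?i = "t mod phase_rounds div 2"
    have "even (t mod phase_rounds)"
      using that by (simp add: phase_rounds_def dvd_mod_iff)
    then have t: "t = ?k * phase_rounds + 2 * ?i" by simp
    have "t mod phase_rounds < (2 * g + 1) * 2"
      using mod_less_divisor [OF phase_rounds_pos, of t] by (simp add: phase_rounds_def)
    then have "?i < 2 * g + 1" by (rule less_mult_imp_div_less)
    from num_requests_le [OF this, of ?k] t have "num_messages t \<le> active_bound (?k mod N) * contact_bound (?k mod N)"
      by simp
    also have "\<dots> \<le> B" using B N_pos by simp
    finally show ?thesis .
  qed
  show ?thesis
  proof (cases "even t")
    case False
    then obtain s where "t = Suc s" "even s" by (cases t) auto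
    then show ?thesis using num_answers_le even_le le_trans by blast
  qed (rule even_le)
qed

end

context expander_protocol
begin

section \<open>Correctness and total cost of the protocol\<close>

definition duration :: nat where
  "duration = W * (2 * N * phase_rounds)"

lemma solves: "solves_gossip n alg duration"
  unfolding solves_gossip_def Let_def
proof (intro allI ballI conjI impI)
  fix inp adv p
  interpret execution n N g \<delta> D f inp adv .
  interpret expander_execution n N g \<delta> D f b W m \<mu> inp adv ..
  have T: "duration = W * window" by (simp add: duration_def window_def)
  have known: "known alg p (inp p) (history (conf t) p) = KN t p" for t
    by (simp add: alg_def St_def)
  assume p: "p \<in> AL duration"
  then show "known alg p (inp p) (history (conf duration) p) \<subseteq> rumors n inp"
    unfolding known by (rule KN_rumors)
  fix q w assume q: "q \<in> AL duration" and w: "inp q = Some w"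
  have "w \<in> KN 0 q" using w by (simp add: St_0 init_def)
  then show "w \<in> known alg p (inp p) (history (conf duration) p)"
    unfolding known using survivors_exchange p q unfolding T by blast
qed

lemma bits:
  assumes "n * (D 0 + (if 1 < N then D 1 else n)) \<le> B"
    and "\<And>j. Suc j < N \<Longrightarrow> (m j + \<mu> j) * (D (Suc j) + (if Suc (Suc j) < N then D (Suc (Suc j)) else n)) \<le> B"
  shows "total_bits n alg inp adv duration \<le> duration * B * (3 * rumor_bits n inp + 2)"
proof -
  interpret execution n N g \<delta> D f inp adv .
  interpret expander_execution n N g \<delta> D f b W m \<mu> inp adv ..
  have "active_bound j * contact_bound j \<le> B" if "j < N" for j
    using assms that by (cases j) (auto simp: active_bound_def contact_bound_def)
  then have "(\<Sum>t<duration. num_messages t) \<le> (\<Sum>t<duration. B)"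
    by (intro sum_mono num_messages_le)
  then have "(\<Sum>t<duration. num_messages t) * (3 * rumor_bits n inp + 2)
      \<le> duration * B * (3 * rumor_bits n inp + 2)"
    by (intro mult_le_mono1) simp
  with total_bits_le [of duration] show ?thesis by (rule le_trans)
qed

end

section \<open>Parameters\<close>

text \<open>G serves as g, as W and as a bound on the number of scales: G windows of at most 2 G
  phases with at most 6 G rounds each. For one round, at most 17 b m_j processes are active after
  phase j, and their contacts belong to scales j + 1 and j + 2. This gives 17 b m_j * 2 D_(j+2) =
  544 b l r^2 (m_j r^j) messages, and m_j r^j \<le> 2 n.\<close>

lemma gossip_algorithm_exists:
  fixes n b l G :: nat
  assumes n: "n \<ge> 3" and b: "b \<ge> 2" and l: "ln (real n) \<le> real l" and ln: "16 * l < n"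
    and G: "n < b ^ G"
  obtains A T where "solves_gossip n A T" "T \<le> 12 * G ^ 3"
    "\<And>inp adv. total_bits n A inp adv T \<le> T * (1088 * b * l * (64 * b^2)^2 * n) * (3 * rumor_bits n inp + 2)"
proof -
  \<comment> \<open>The scale condition amounts to 32 b^2 m_(j+1) \<le> m_j; the other factor 2 in
    64 compensates the rounding in \<open>m\<close>.\<close>
  define r where "r = 64 * b^2"
  define D where "D j = 16 * l * r ^ j" for j
  \<comment> \<open>This is n / r^j rounded up. Rounding up gives
    \<open>m j * D j \<ge> 16 * l * n\<close>, and as r^j \<le> n at the scales in use, it at most
    doubles the product.\<close>
  define m where "m j = (n + (r ^ j - 1)) div r ^ j" for j
  define \<mu> where "\<mu> j = 16 * b * m j" for j
  define \<delta> where "\<delta> = 72 * b * l"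
  \<comment> \<open>The first scale whose degree would reach n: contacting everybody in the last
    phase costs no more than a graph of degree \<open>D N\<close>.\<close>
  define N where "N = (LEAST j. n \<le> D j)"
  have l1: "l \<ge> 1"
  proof -
    have "ln (real n) > 0" using n by simp
    then show ?thesis using l by (cases l) auto
  qed
  have rb: "b \<le> r" using b by (simp add: r_def power2_eq_square)
  have r1: "r ^ j \<ge> 1" for j using b by (simp add: r_def)
  have DG: "n \<le> D G"
  proof -
    have "n \<le> 1 * b ^ G" using G by simp
    also have "\<dots> \<le> (16 * l) * r ^ G" using l1 rb by (intro mult_mono power_mono) auto
    finally show ?thesis by (simp add: D_def)
  qed
  have DN: "n \<le> D N" unfolding N_def by (rule LeastI [of "\<lambda>j. n \<le> D j", OF DG])
  have NG: "N \<le> G" unfolding N_def by (rule Least_le [of "\<lambda>j. n \<le> D j", OF DG])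
  have lessN: "D j < n" if "j < N" for j
    using not_less_Least [of j "\<lambda>j. n \<le> D j"] that by (simp add: N_def)
  \<comment> \<open>\<open>16 * l < n\<close> says that \<open>D 0 < n\<close>, so there is at least
    one scale.\<close>
  have N0: "N \<ge> 1"
  proof (rule ccontr)
    assume "\<not> ?thesis"
    then have "N = 0" by simp
    then show False using DN ln by (simp add: D_def)
  qed
  have rj: "r ^ j \<le> n" if "j < N" for j
  proof -
    have "1 * r ^ j \<le> D j" unfolding D_def using l1 by (intro mult_le_mono1) simp
    then show ?thesis using lessN [OF that] by simp
  qed
  have m_lo: "n \<le> m j * r ^ j" for j
  proof -
    have "n + (r ^ j - 1) < r ^ j + m j * r ^ j"
      unfolding m_def by (rule dividend_less_div_times) (use r1 [of j] in linarith)
    then show ?thesis using r1 [of j] by linarith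
  qed
  have m_hi: "m j * r ^ j \<le> 2 * n" if "j < N" for j
  proof -
    have "m j * r ^ j \<le> n + (r ^ j - 1)" unfolding m_def by (rule div_times_less_eq_dividend)
    then show ?thesis using rj [OF that] by simp
  qed
  have m1: "m j \<ge> 1" for j using m_lo [of j] n by (cases "m j") auto
  have m_dec: "m (Suc j) \<le> m j" if "Suc j < N" and "32 * b^2 * m (Suc j) \<le> m j" for j
  proof -
    have "1 * m (Suc j) \<le> 32 * b^2 * m (Suc j)" using b by (intro mult_le_mono1) simp
    also note that(2)
    finally show ?thesis by simp
  qed
  have scale: "32 * b^2 * m (Suc j) \<le> m j" if j: "Suc j < N" for j
  proof -
    have "2 * (32 * b^2 * m (Suc j) * r ^ j) = m (Suc j) * r ^ Suc j" by (simp add: r_def)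
    also have "\<dots> \<le> 2 * n" by (rule m_hi [OF j])
    also have "\<dots> \<le> 2 * (m j * r ^ j)" using m_lo [of j] by simp
    finally have "(32 * b^2 * m (Suc j)) * r ^ j \<le> m j * r ^ j"
      by (rule mult_left_le_imp_le) simp
    then show ?thesis by (rule mult_right_le_imp_le) (use r1 [of j] in linarith)
  qed
  have "\<exists>f. expander {1..n} f (D j) (m j) (\<mu> j) \<delta> b" if j: "j < N" for j
  proof -
    have c3: "card {1..n} \<ge> 3" and cl: "ln (real (card {1..n})) \<le> real l"
      using n l by simp_all
    have d1: "16 * l * card {1..n} \<le> m j * D j"
      using mult_le_mono2 [OF m_lo [of j], of "16 * l"] by (simp add: D_def mult_ac)
    have d2: "m j * D j \<le> 32 * l * card {1..n}"
      using mult_le_mono2 [OF m_hi [OF j], of "16 * l"] by (simp add: D_def mult_ac)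
    have b1: "b \<ge> 1" using b by simp
    show ?thesis
    proof (rule random_digraph_exists [OF finite_atLeastAtMost c3 b1 cl d1 d2])
      fix f
      assume f: "\<And>p k. p \<in> {1..n} \<Longrightarrow> k < D j \<Longrightarrow> f p k \<in> {1..n}"
        "\<And>X Y. X \<subseteq> {1..n} \<Longrightarrow> Y \<subseteq> {1..n} \<Longrightarrow> X \<noteq> {} \<Longrightarrow> card X \<le> m j \<Longrightarrow>
          72 * b * l * card X \<le> hits f (D j) X Y \<Longrightarrow> b * card X < card Y"
        "\<And>X Y. X \<subseteq> {1..n} \<Longrightarrow> Y \<subseteq> {1..n} \<Longrightarrow> card X = m j \<Longrightarrow> card Y = 16 * b * m j \<Longrightarrow>
          72 * b * l * m j \<le> hits f (D j) X Y"
      have "expander {1..n} f (D j) (m j) (\<mu> j) \<delta> b"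
        unfolding expander_def \<mu>_def \<delta>_def using f m1 [of j] b1 l1 by simp
      then show "\<exists>f. expander {1..n} f (D j) (m j) (\<mu> j) \<delta> b" by blast
    qed
  qed
  then have "\<forall>j. \<exists>f. j < N \<longrightarrow> expander {1..n} f (D j) (m j) (\<mu> j) \<delta> b" by blast
  then obtain f where f: "\<And>j. j < N \<Longrightarrow> expander {1..n} (f j) (D j) (m j) (\<mu> j) \<delta> b"
    by metis
  interpret expander_protocol n N G \<delta> D f b G m \<mu>
  proof (rule expander_protocol.intro)
    show "expander {1..n} (f j) (D j) (m j) (\<mu> j) \<delta> b" if "j < N" for j
      by (rule f [OF that])
    show "N \<ge> 1" by (rule N0)
    show "n \<le> b ^ G" "n < b ^ G" using G by simp_all
    show "m j \<le> n" if "j < N" for j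
    proof -
      have "n * 1 \<le> n * r ^ j" using r1 by (rule mult_le_mono2)
      then have "n + (r ^ j - 1) < (n + 1) * r ^ j"
        unfolding add_mult_distrib using r1 [of j] by linarith
      then have "m j < n + 1" unfolding m_def by (rule less_mult_imp_div_less)
      then show ?thesis by simp
    qed
    show "m (Suc j) \<le> m j" "2 * b * \<mu> (Suc j) \<le> m j" if "Suc j < N" for j
      using m_dec [OF that] scale [OF that] by (simp_all add: \<mu>_def power2_eq_square)
  qed
  let ?B = "1088 * b * l * r^2 * n"
  have D_mono: "D i \<le> D j" if "i \<le> j" for i j
    unfolding D_def using that r1 [of 1] by (intro mult_le_mono2 power_increasing) auto
  have next_le: "(if Suc j < N then D (Suc j) else n) \<le> D (Suc j)" if "j < N" for j
  proof (cases "Suc j < N")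
    case False
    then have "N = Suc j" using that by simp
    then show ?thesis using DN by simp
  qed simp
  have "n * (D 0 + (if 1 < N then D 1 else n)) \<le> n * (D 1 + D 1)"
    using next_le [of 0] N0 D_mono [of 0 1] by (intro mult_le_mono2 add_mono) auto
  also have "\<dots> = 32 * l * n * r" by (simp add: D_def)
  also have "\<dots> \<le> 32 * l * n * (34 * b * r^2)"
  proof -
    have "r * 1 \<le> r * (34 * b * r)" using b r1 [of 1] by (intro mult_le_mono2) simp
    then show ?thesis by (intro mult_le_mono2) (simp add: power2_eq_square)
  qed
  finally have B0: "n * (D 0 + (if 1 < N then D 1 else n)) \<le> ?B" by (simp add: mult_ac)
  have B1: "(m j + \<mu> j) * (D (Suc j) + (if Suc (Suc j) < N then D (Suc (Suc j)) else n)) \<le> ?B"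
    if j: "Suc j < N" for j
  proof -
    have "m j + \<mu> j \<le> 17 * b * m j" using b by (simp add: \<mu>_def)
    moreover have "D (Suc j) + (if Suc (Suc j) < N then D (Suc (Suc j)) else n) \<le> 2 * D (Suc (Suc j))"
      using next_le [OF j] D_mono [of "Suc j" "Suc (Suc j)"] by simp
    ultimately have "(m j + \<mu> j) * (D (Suc j) + (if Suc (Suc j) < N then D (Suc (Suc j)) else n)) \<le>
        (17 * b * m j) * (2 * D (Suc (Suc j)))" by (rule mult_le_mono)
    also have "\<dots> = (544 * b * l * r^2) * (m j * r ^ j)" by (simp add: D_def power2_eq_square)
    also have "\<dots> \<le> (544 * b * l * r^2) * (2 * n)"
      using m_hi [of j] j by (intro mult_le_mono2) simp
    finally show ?thesis by (simp add: mult_ac)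
  qed
  show thesis
  proof (rule that [of alg duration])
    show "solves_gossip n alg duration" by (rule solves)
    have "G \<ge> 1" using G n by (cases G) auto
    then have "2 * (2 * G + 1) \<le> 6 * G" by simp
    then have "duration \<le> G * (2 * G * (6 * G))"
      unfolding duration_def phase_rounds_def using NG
      by (intro mult_le_mono2 mult_le_mono [of "2 * N" "2 * G"]) simp_all
    then show "duration \<le> 12 * G ^ 3" by (simp add: power3_eq_cube)
    show "total_bits n alg inp adv duration \<le>
        duration * (1088 * b * l * (64 * b^2)^2 * n) * (3 * rumor_bits n inp + 2)" for inp adv
      using bits [OF B0 B1] by (simp only: r_def)
  qed
qed

text \<open>The leading True distinguishes an empty rumor from the absence of a message.\<close>

definition broadcast :: algorithm where
  "broadcast =
     \<lparr> message = (\<lambda>p x hs q. case x of None \<Rightarrow> [] | Some w \<Rightarrow> True # w),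
       known = (\<lambda>p x hs. set_option x \<union> {tl (h q) |h q. h \<in> set hs \<and> h q \<noteq> []}) \<rparr>"

lemma broadcast_solves: "solves_gossip n broadcast 1"
  unfolding solves_gossip_def Let_def
proof (intro allI ballI conjI impI)
  fix inp adv p
  let ?start = "run n broadcast inp adv 0" and ?c = "run n broadcast inp adv 1"
  assume p: "p \<in> alive ?c"
  have sub: "alive ?c \<subseteq> {1..n}" by (auto simp: alive_Suc run_0)
  have h: "history ?c p = [delivered broadcast inp adv ?start p]"
    using history_Suc [of p n broadcast inp adv 0] p by (simp add: run_0)
  have sent: "delivered broadcast inp adv ?start p q \<noteq> [] \<Longrightarrow>
      q \<in> {1..n} \<and> (\<exists>w. inp q = Some w \<and> delivered broadcast inp adv ?start p q = True # w)" for q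
    by (auto simp: delivered_def outgoing_def run_0 broadcast_def split: option.splits if_splits)
  show "known broadcast p (inp p) (history ?c p) \<subseteq> rumors n inp"
  proof
    fix w assume "w \<in> known broadcast p (inp p) (history ?c p)"
    then consider "inp p = Some w"
      | q where "delivered broadcast inp adv ?start p q \<noteq> []" "w = tl (delivered broadcast inp adv ?start p q)"
      unfolding h by (auto simp: broadcast_def)
    then show "w \<in> rumors n inp"
    proof cases
      case 1
      then show ?thesis using p sub by (auto simp: rumors_def)
    next
      case 2
      then show ?thesis using sent [of q] by (auto simp: rumors_def)
    qed
  qed
  fix q w assume q: "q \<in> alive ?c" and w: "inp q = Some w"
  show "w \<in> known broadcast p (inp p) (history ?c p)"
  proof (cases "q = p")
    case True
    then show ?thesis using w by (simp add: broadcast_def)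
  next
    case False
    have "delivered broadcast inp adv ?start p q = True # w"
      using q w False by (simp add: alive_Suc delivered_def outgoing_def broadcast_def)
    moreover define X where "X = delivered broadcast inp adv ?start p"
    ultimately have "\<exists>h q. w = tl (h q) \<and> h \<in> set [X] \<and> h q \<noteq> []"
      by (intro exI [of _ X] exI [of _ q]) simp
    then show ?thesis unfolding h X_def [symmetric] by (simp add: broadcast_def)
  qed
qed

lemma broadcast_bits: "total_bits n broadcast inp adv 1 \<le> n * (n * (rumor_bits n inp + 1))"
proof -
  have "length (outgoing broadcast inp (run n broadcast inp adv 0) p q) \<le> rumor_bits n inp + 1"
    if p: "p \<in> {1..n}" for p q
  proof (cases "inp p")
    case None
    then show ?thesis by (simp add: outgoing_def broadcast_def)
  next
    case (Some w)
    then have "w \<in> rumors n inp" using p by (auto simp: rumors_def)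
    then have "length w \<le> rumor_bits n inp"
      unfolding rumor_bits_def by (rule member_le_sum) (simp_all add: finite_rumors)
    then show ?thesis using Some by (simp add: outgoing_def broadcast_def)
  qed
  then have "(\<Sum>p\<in>{1..n}. \<Sum>q\<in>{1..n}. length (outgoing broadcast inp (run n broadcast inp adv 0) p q))
      \<le> (\<Sum>p\<in>{1..n}. \<Sum>q\<in>{1..n}. rumor_bits n inp + 1)"
    by (intro sum_mono)
  then show ?thesis by (simp add: total_bits_def)
qed

text \<open>The cost per round is a multiple of b^5 l n. Taking b as the fourth root keeps b^5 below
  a^2, while log b remains a constant fraction of log a, so that G is O(L). As 256 = 4^4 = 2^8, the
  fourth root of a is at least 4 and the eighth root at least 2.\<close>

lemma gossip_bound:
  fixes n a :: nat
  assumes n: "n \<ge> 3" and a: "256 \<le> a" "a < n" and l: "16 * nat \<lceil>ln (real n)\<rceil> < n"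
  shows "\<exists>A T. solves_gossip n A T \<and>
    real T \<le> 9000 * (log 2 n / log 2 a) ^ 3 \<and>
    (\<forall>inp adv. real (total_bits n A inp adv T) / n \<le>
      9000 * 4500000 * ((log 2 n / log 2 a) ^ 4 * real a ^ 2 * real (nat \<lceil>ln (real n)\<rceil>) * (3 * real (rumor_bits n inp) + 2)))"
proof -
  define L where "L = log 2 n / log 2 a"
  define b where "b = nat \<lfloor>real a powr (1/4)\<rfloor>"
  define l where "l = nat \<lceil>ln (real n)\<rceil>"
  define G where "G = nat \<lfloor>log b n\<rfloor> + 1"
  have a1: "real a > 1" using a by simp
  have q: "real a powr (1/4) \<ge> 4"
  proof -
    have "(4::real) = (4 powr 4) powr (1/4)" by (simp add: powr_powr)
    also have "\<dots> \<le> real a powr (1/4)" using a by (intro powr_mono2) auto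
    finally show ?thesis .
  qed
  have b_up: "real b \<le> real a powr (1/4)" unfolding b_def by simp
  have b4: "b \<ge> 4" using q unfolding b_def by (simp add: le_nat_iff le_floor_iff)
  \<comment> \<open>With x the eighth root of a, x \<ge> 2 gives x^2 \<ge> 2 x, and rounding x^2
    down loses less than 1, hence leaves at least x.\<close>
  have b_lo: "real a powr (1/8) \<le> b"
  proof -
    have "real a powr (1/8) \<ge> 2"
    proof -
      have "(2::real) = (2 powr 8) powr (1/8)" by (simp add: powr_powr)
      also have "\<dots> \<le> real a powr (1/8)" using a by (intro powr_mono2) auto
      finally show ?thesis .
    qed
    moreover have "real a powr (1/4) = real a powr (1/8) * real a powr (1/8)"
      by (simp add: powr_add [symmetric])
    ultimately have "2 * real a powr (1/8) \<le> real a powr (1/4)"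
      by (simp add: mult_right_mono)
    moreover have "real a powr (1/4) < real b + 1" unfolding b_def by linarith
    moreover note \<open>real a powr (1/8) \<ge> 2\<close>
    ultimately show ?thesis by linarith
  qed
  have loga: "log 2 a > 0" using a1 by simp
  have logb: "log 2 a / 8 \<le> log 2 b"
  proof -
    have "log 2 a / 8 = log 2 (real a powr (1/8))" using a1 by (simp add: log_powr)
    also have "\<dots> \<le> log 2 b" using b_lo a1 b4 by (subst log_le_cancel_iff) auto
    finally show ?thesis .
  qed
  have L1: "L \<ge> 1" unfolding L_def using a loga by (simp add: field_simps)
  have logn: "log 2 n > 0" using n by simp
  have lb: "log b n \<le> 8 * L"
  proof -
    have "log b n = log 2 n / log 2 b" using b4 n by (simp add: log_def)
    also have "\<dots> \<le> log 2 n / (log 2 a / 8)"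
      using logb loga logn by (intro divide_left_mono mult_pos_pos) auto
    finally show ?thesis by (simp add: L_def mult.commute)
  qed
  have lb0: "log b n \<ge> 0" using b4 n by simp
  have GL: "real G \<le> 9 * L"
  proof -
    have "real G \<le> log b n + 1" unfolding G_def using lb0 by simp
    then show ?thesis using lb L1 by linarith
  qed
  have nG: "n < b ^ G"
  proof -
    have "log b n < real G" unfolding G_def using lb0 by linarith
    then have "real n < real b powr real G" using b4 n by (subst (asm) log_less_iff) auto
    also have "\<dots> = real (b ^ G)" using b4 by (simp add: powr_realpow)
    finally show ?thesis by (simp only: of_nat_less_iff)
  qed
  have ln: "ln (real n) \<le> real l" unfolding l_def by linarith
  obtain A T where A: "solves_gossip n A T" and T: "T \<le> 12 * G ^ 3"
    and bits: "\<And>inp adv. total_bits n A inp adv T \<le> T * (1088 * b * l * (64 * b^2)^2 * n) * (3 * rumor_bits n inp + 2)"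
    by (rule gossip_algorithm_exists [OF n _ ln _ nG]) (use b4 assms in \<open>simp_all add: l_def\<close>)
  have TL: "real T \<le> 9000 * L ^ 3"
  proof -
    have "real T \<le> 12 * real G ^ 3" using T by (metis of_nat_le_iff of_nat_mult of_nat_numeral of_nat_power)
    also have "\<dots> \<le> 12 * (9 * L) ^ 3" using GL by (intro mult_left_mono power_mono) auto
    also have "\<dots> \<le> 9000 * L ^ 3" using L1 by (simp add: power_mult_distrib)
    finally show ?thesis .
  qed
  have b5: "real b ^ 5 \<le> real a ^ 2"
  proof -
    have "real b ^ 5 \<le> (real a powr (1/4)) ^ 5" using b_up by (intro power_mono) auto
    also have "\<dots> = real a powr (5/4)" using a1 by (simp add: powr_realpow [symmetric] powr_powr)
    also have "\<dots> \<le> real a powr 2" using a1 by (intro powr_mono) auto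
    finally show ?thesis using a1 by (simp add: powr_numeral)
  qed
  have b_pow: "1088 * b * l * (64 * b^2)^2 * n = 4456448 * (b ^ 5 * l * n)"
    by algebra
  have "real (total_bits n A inp adv T) / n \<le>
      9000 * 4500000 * (L ^ 4 * real a ^ 2 * real l * (3 * real (rumor_bits n inp) + 2))" for inp adv
  proof -
    let ?R = "3 * real (rumor_bits n inp) + 2"
    have "real (total_bits n A inp adv T) \<le> real (T * (1088 * b * l * (64 * b^2)^2 * n) * (3 * rumor_bits n inp + 2))"
      using bits by (simp only: of_nat_le_iff)
    also have "\<dots> = real T * (4456448 * (real b ^ 5 * real l * real n)) * ?R"
      unfolding b_pow by (simp add: algebra_simps)
    also have "\<dots> \<le> (9000 * L ^ 3) * (4500000 * (real a ^ 2 * real l * real n)) * ?R"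
      using TL b5 L1 by (intro mult_right_mono mult_mono) auto
    \<comment> \<open>\<open>L \<ge> 1\<close> because a < n.\<close>
    also have "\<dots> \<le> (9000 * L ^ 4) * (4500000 * (real a ^ 2 * real l * real n)) * ?R"
      using L1 by (intro mult_right_mono mult_left_mono power_increasing) auto
    finally show ?thesis using n by (simp add: field_simps)
  qed
  with A TL show ?thesis unfolding L_def l_def by blast
qed

text \<open>Here the ratio of logarithms can be below 1, and its fourth power must not destroy the
  bound. It does not: a^2 / (log a)^4 is still at least a, hence at least the n messages per
  process.\<close>

lemma broadcast_bound:
  fixes n a :: nat
  assumes n: "n \<ge> 2" and a: "a \<ge> n" and poly: "log 2 (real a) ^ 4 \<le> real a"
  shows "real (total_bits n broadcast inp adv 1) / n \<le>
    (log 2 n / log 2 a) ^ 4 * real a ^ 2 * (real (rumor_bits n inp) + 1)"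
proof -
  have logn: "log 2 n \<ge> 1" using n by simp
  have loga: "log 2 a > 0" using a n by simp
  have "real n \<le> real a" using a by simp
  also have "\<dots> = real a ^ 2 / real a" using a n by (simp add: power2_eq_square)
  also have "\<dots> \<le> real a ^ 2 / log 2 a ^ 4"
    using poly loga a n by (intro divide_left_mono mult_pos_pos zero_less_power) auto
  also have "\<dots> \<le> log 2 n ^ 4 * (real a ^ 2 / log 2 a ^ 4)"
  proof -
    have "0 \<le> real a ^ 2 / log 2 a ^ 4" by simp
    from mult_right_mono [OF one_le_power [OF logn] this] show ?thesis by (simp only: mult_1)
  qed
  also have "\<dots> = (log 2 n / log 2 a) ^ 4 * real a ^ 2" by (simp add: power_divide)
  finally have *: "real n \<le> (log 2 n / log 2 a) ^ 4 * real a ^ 2" .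
  have "real (total_bits n broadcast inp adv 1) \<le> real (n * (n * (rumor_bits n inp + 1)))"
    using broadcast_bits by (simp only: of_nat_le_iff)
  then have "real (total_bits n broadcast inp adv 1) / n \<le> real n * (real (rumor_bits n inp) + 1)"
    using n by (simp add: field_simps)
  also have "\<dots> \<le> (log 2 n / log 2 a) ^ 4 * real a ^ 2 * (real (rumor_bits n inp) + 1)"
    using * by (intro mult_right_mono) auto
  finally show ?thesis .
qed

section \<open>Asymptotic form of the bounds\<close>

lemma bigomega_log_ge:
  fixes u :: "nat \<Rightarrow> nat"
  assumes "(\<lambda>n. real (u n)) \<in> \<Omega>(\<lambda>n. log 2 (real n))"
  obtains c where "c > 0" "\<forall>\<^sub>F n in sequentially. c * log 2 (real n) \<le> real (u n)"
proof (rule landau_omega.bigE [OF assms])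
  fix c :: real
  assume c: "c > 0" and "\<forall>\<^sub>F n in sequentially. c * norm (log 2 (real n)) \<le> norm (real (u n))"
  from this(2) have "\<forall>\<^sub>F n in sequentially. c * log 2 (real n) \<le> real (u n)"
  proof eventually_elim
    case (elim n)
    have "c * log 2 (real n) \<le> c * norm (log 2 (real n))"
      using c by (intro mult_left_mono) auto
    then show ?case using elim by simp
  qed
  with c show thesis by (rule that)
qed

theorem theorem4:
  fixes d \<alpha> :: "nat \<Rightarrow> nat"
  assumes "(\<lambda>n. real (d n)) \<in> \<Omega>(\<lambda>n. log 2 (real n))"
    and "(\<lambda>n. real (\<alpha> n)) \<in> \<Omega>(\<lambda>n. log 2 (real n))"
  shows "\<exists>(A :: nat \<Rightarrow> algorithm) (T :: nat \<Rightarrow> nat).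
    (\<forall>n\<ge>1. solves_gossip n (A n) (T n)) \<and>
    (\<lambda>n. real (T n)) \<in> O(\<lambda>n. max 1 ((log 2 (real n) / log 2 (real (\<alpha> n))) ^ 3)) \<and>
    (\<exists>C>0. \<forall>\<^sub>F n in sequentially. \<forall>inp adv.
       real (total_bits n (A n) inp adv (T n)) / real n
         \<le> C * ((log 2 (real n) / log 2 (real (\<alpha> n))) ^ 4 * real (d n) * real (\<alpha> n) ^ 2
                * (real (rumor_bits n inp) + log 2 (real n))))"
proof -
  define L where "L n = log 2 (real n) / log 2 (real (\<alpha> n))" for n
  obtain c1 where c1: "c1 > 0" and d: "\<forall>\<^sub>F n in sequentially. c1 * log 2 (real n) \<le> real (d n)"
    using assms(1) by (rule bigomega_log_ge)
  obtain c2 where c2: "c2 > 0" and \<alpha>: "\<forall>\<^sub>F n in sequentially. c2 * log 2 (real n) \<le> real (\<alpha> n)"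
    using assms(2) by (rule bigomega_log_ge)
  have log_top: "filterlim (\<lambda>n. log 2 (real n)) at_top sequentially" by real_asymp
  have ev1: "\<forall>\<^sub>F n in sequentially. 256 / c2 \<le> log 2 (real n)"
    using log_top by (simp add: filterlim_at_top)
  have "\<forall>\<^sub>F x in at_top. log 2 x ^ 4 \<le> (x::real)" by real_asymp
  then obtain x0 where x0: "\<And>x. x \<ge> x0 \<Longrightarrow> log 2 x ^ 4 \<le> (x::real)"
    by (auto simp: eventually_at_top_linorder)
  have ev2: "\<forall>\<^sub>F n in sequentially. real n \<ge> x0" by real_asymp
  have ev3: "\<forall>\<^sub>F n in sequentially. 16 * (ln (real n) + 1) < real n" by real_asymp
  have "\<forall>\<^sub>F n in sequentially. n \<ge> 3 \<and> c1 * log 2 (real n) \<le> real (d n) \<and> \<alpha> n \<ge> 256 \<and>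
      16 * nat \<lceil>ln (real n)\<rceil> < n \<and> real n \<ge> x0"
    using eventually_ge_at_top [of 3] d \<alpha> ev1 ev2 ev3
  proof eventually_elim
    case (elim n)
    have "256 = c2 * (256 / c2)" using c2 by simp
    also have "\<dots> \<le> c2 * log 2 (real n)" using elim c2 by (intro mult_left_mono) auto
    also have "\<dots> \<le> real (\<alpha> n)" by (rule elim)
    finally have "256 \<le> \<alpha> n" by simp
    moreover have "16 * nat \<lceil>ln (real n)\<rceil> < n"
    proof -
      have "real (nat \<lceil>ln (real n)\<rceil>) \<le> ln (real n) + 1"
        using elim by (simp add: of_nat_nat)
      then have "16 * real (nat \<lceil>ln (real n)\<rceil>) \<le> 16 * (ln (real n) + 1)"
        by (rule mult_left_mono) simp
      also note elim(6)
      finally have "16 * real (nat \<lceil>ln (real n)\<rceil>) < real n" .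
      then have "real (16 * nat \<lceil>ln (real n)\<rceil>) < real n"
        by (simp only: of_nat_mult of_nat_numeral)
      then show ?thesis by (simp only: of_nat_less_iff)
    qed
    ultimately show ?case using elim by simp
  qed
  then obtain n0 where n0: "\<And>n. n \<ge> n0 \<Longrightarrow> n \<ge> 3 \<and> c1 * log 2 (real n) \<le> real (d n) \<and> \<alpha> n \<ge> 256 \<and>
      16 * nat \<lceil>ln (real n)\<rceil> < n \<and> real n \<ge> x0"
    by (auto simp: eventually_sequentially)
  \<comment> \<open>The factor 6 is 2 * 3: the rounded logarithm is at most 2 log n, and 3 |M| + 2
    is at most 3 (|M| + log n).\<close>
  define K :: real where "K = 9000 * 4500000 * 6"
  define C where "C = K / c1"
  have C0: "C > 0" using c1 by (simp add: C_def K_def)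
  \<comment> \<open>Below \<open>n0\<close> only correctness is required, and broadcasting provides
    it; the cost bounds are asymptotic.\<close>
  define good where "good n A T \<longleftrightarrow> solves_gossip n A T \<and>
    (n \<ge> n0 \<longrightarrow> real T \<le> 9000 * max 1 (L n ^ 3) \<and>
      (\<forall>inp adv. real (total_bits n A inp adv T) / real n
         \<le> C * (L n ^ 4 * real (d n) * real (\<alpha> n) ^ 2 * (real (rumor_bits n inp) + log 2 (real n)))))"
    for n A T
  have "\<exists>A T. good n A T" for n
  proof (cases "n \<ge> n0")
    case False
    then show ?thesis using broadcast_solves unfolding good_def by blast
  next
    case True
    note large = n0 [OF True]
    have log1: "log 2 n \<ge> 1" using large by simp
    have L0: "L n ^ 4 \<ge> 0" by simp
    \<comment> \<open>The factor log n that stems from the degrees of the random digraphs is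
      absorbed by d, which dominates it up to \<open>c1\<close>.\<close>
    have final: "real (total_bits n A inp adv T) / real n
         \<le> C * (L n ^ 4 * real (d n) * real (\<alpha> n) ^ 2 * (real (rumor_bits n inp) + log 2 (real n)))"
      if "real (total_bits n A inp adv T) / real n \<le>
        K * (L n ^ 4 * real (\<alpha> n) ^ 2 * log 2 (real n) * (real (rumor_bits n inp) + log 2 (real n)))"
      for A inp adv T
    proof -
      let ?R = "real (rumor_bits n inp) + log 2 (real n)"
      have "log 2 (real n) \<le> real (d n) / c1" using large c1 by (simp add: field_simps)
      then have "K * (L n ^ 4 * real (\<alpha> n) ^ 2 * log 2 (real n) * ?R) \<le>
          K * (L n ^ 4 * real (\<alpha> n) ^ 2 * (real (d n) / c1) * ?R)"
        using log1 by (intro mult_left_mono mult_right_mono) (auto simp: K_def)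
      also have "\<dots> = C * (L n ^ 4 * real (d n) * real (\<alpha> n) ^ 2 * ?R)"
        by (simp add: C_def)
      finally show ?thesis using that by linarith
    qed
    show ?thesis
    proof (cases "\<alpha> n < n")
      case True
      obtain A T where A: "solves_gossip n A T" and T: "real T \<le> 9000 * L n ^ 3"
        and bits: "\<And>inp adv. real (total_bits n A inp adv T) / n \<le>
          9000 * 4500000 * (L n ^ 4 * real (\<alpha> n) ^ 2 * real (nat \<lceil>ln (real n)\<rceil>) * (3 * real (rumor_bits n inp) + 2))"
        using gossip_bound [of n "\<alpha> n"] large True unfolding L_def by blast
      have "real (total_bits n A inp adv T) / real n \<le>
        K * (L n ^ 4 * real (\<alpha> n) ^ 2 * log 2 (real n) * (real (rumor_bits n inp) + log 2 (real n)))"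
        for inp adv
      proof -
        let ?R = "real (rumor_bits n inp)"
        have "ln (real n) \<le> log 2 (real n)"
        proof -
          have "ln 2 \<le> (1::real)" using ln_le_minus_one [of 2] by simp
          then have "ln (real n) * ln 2 \<le> ln (real n) * 1" using large by (intro mult_left_mono) auto
          then show ?thesis by (simp add: log_def field_simps)
        qed
        moreover have "real (nat \<lceil>ln (real n)\<rceil>) \<le> ln (real n) + 1"
          using large by (simp add: of_nat_nat)
        ultimately have l: "real (nat \<lceil>ln (real n)\<rceil>) \<le> 2 * log 2 (real n)" using log1 by linarith
        note bits [of inp adv]
        also have "9000 * 4500000 * (L n ^ 4 * real (\<alpha> n) ^ 2 * real (nat \<lceil>ln (real n)\<rceil>) * (3 * ?R + 2)) \<le>
            9000 * 4500000 * (L n ^ 4 * real (\<alpha> n) ^ 2 * (2 * log 2 (real n)) * (3 * (?R + log 2 (real n))))"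
          using l log1 by (intro mult_left_mono mult_mono) auto
        also have "\<dots> = K * (L n ^ 4 * real (\<alpha> n) ^ 2 * log 2 (real n) * (?R + log 2 (real n)))"
          by (simp add: K_def)
        finally show ?thesis .
      qed
      moreover have "real T \<le> 9000 * max 1 (L n ^ 3)" using T by linarith
      ultimately show ?thesis using A final unfolding good_def by blast
    next
      case False
      have "log 2 (real (\<alpha> n)) ^ 4 \<le> real (\<alpha> n)" using False large by (intro x0) linarith
      then have b: "real (total_bits n broadcast inp adv 1) / n \<le>
          L n ^ 4 * real (\<alpha> n) ^ 2 * (real (rumor_bits n inp) + 1)" for inp adv
        using broadcast_bound [of n "\<alpha> n"] False large unfolding L_def by simp
      have "real (total_bits n broadcast inp adv 1) / real n \<le>
        K * (L n ^ 4 * real (\<alpha> n) ^ 2 * log 2 (real n) * (real (rumor_bits n inp) + log 2 (real n)))"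
        for inp adv
      proof -
        let ?R = "real (rumor_bits n inp)"
        have "L n ^ 4 * real (\<alpha> n) ^ 2 * (?R + 1) \<le> L n ^ 4 * real (\<alpha> n) ^ 2 * (?R + log 2 (real n))"
          using log1 by (intro mult_left_mono) auto
        also have "\<dots> \<le> (K * log 2 (real n)) * (L n ^ 4 * real (\<alpha> n) ^ 2 * (?R + log 2 (real n)))"
        proof -
          have "1 * 1 \<le> K * log 2 (real n)" using log1 by (intro mult_mono) (auto simp: K_def)
          then have "1 * (L n ^ 4 * real (\<alpha> n) ^ 2 * (?R + log 2 (real n))) \<le>
              (K * log 2 (real n)) * (L n ^ 4 * real (\<alpha> n) ^ 2 * (?R + log 2 (real n)))"
            using log1 by (intro mult_right_mono) auto
          then show ?thesis by simp
        qed
        finally show ?thesis using b [of inp adv] by (simp add: mult_ac)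
      qed
      \<comment> \<open>For \<alpha> above n the value \<open>L n\<close> is below 1, yet one round
        is spent; hence the maximum with 1 in the round bound.\<close>
      moreover have "real 1 \<le> 9000 * max 1 (L n ^ 3)" by simp
      ultimately show ?thesis using broadcast_solves final unfolding good_def by blast
    qed
  qed
  then obtain A T where AT: "\<And>n. good n (A n) (T n)" by metis
  have "(\<lambda>n. real (T n)) \<in> O(\<lambda>n. max 1 (L n ^ 3))"
  proof (rule landau_o.bigI [of 9000])
    show "\<forall>\<^sub>F n in sequentially. norm (real (T n)) \<le> 9000 * norm (max 1 (L n ^ 3))"
      using eventually_ge_at_top [of n0]
    proof eventually_elim
      case (elim n)
      then have "real (T n) \<le> 9000 * max 1 (L n ^ 3)" using AT [of n] by (simp add: good_def)
      moreover have "norm (max 1 (L n ^ 3)) = max 1 (L n ^ 3)" by simp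
      ultimately show ?case by simp
    qed
  qed simp
  moreover have "\<forall>\<^sub>F n in sequentially. \<forall>inp adv. real (total_bits n (A n) inp adv (T n)) / real n
      \<le> C * (L n ^ 4 * real (d n) * real (\<alpha> n) ^ 2 * (real (rumor_bits n inp) + log 2 (real n)))"
    using eventually_ge_at_top [of n0] by eventually_elim (use AT in \<open>simp add: good_def\<close>)
  moreover have "\<forall>n\<ge>1. solves_gossip n (A n) (T n)" using AT by (simp add: good_def)
  ultimately show ?thesis using C0 unfolding L_def by blast
qed

end
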